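(* Let $i:Z\hookrightarrow X$ be a closed immersion with open complement $j:U\hookrightarrow X$, and assume the recollement axioms for $(i,j)$. Let $A\in\mathcal C(X)$ and let $c\in H^d(X;A)$ satisfy $j^*c=0$. Set $$G_Z(c)=\mathrm{im}\bigl(\delta:H^{d-1}(U;j^*A)\to H_Z^d(X;A)\bigr).$$ Then $G_Z(c)$ acts freely and transitively (by translation) on $\mathrm{Lift}_Z^d(c)$. Hence there is a canonical translation groupoid $\mathscr L_Z(c)=[\mathrm{Lift}_Z^d(c)/\!/G_Z(c)]$: its objects are the supported refinements of $c$, and a morphism $\widetilde c_1\to\widetilde c_2$ is the unique element $g\in G_Z(c)$ such that $\widetilde c_1+g=\widetilde c_2$. Consequently $\mathscr L_Z(c)$ is connected and has trivial automorphism groups. In particular, it is equivalent, as an abstract groupoid, to the terminal groupoid, but not canonically so: choosing such an equivalence (a functor from the terminal groupoid to $\mathscr L_Z(c)$) is the same as choosing a supported refinement of $c$.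
   Context: Setting: to each space $X$ (in a fixed category of spaces with closed immersions, open complements, Cartesian squares and proper morphisms) is attached a stable triangulated category $\mathcal C(X)$ with a symmetric monoidal structure $(\otimes,\mathbf 1_X)$. Each morphism $f:X\to Y$ has exact functors $f^*\dashv f_*$, with $f^*$ symmetric monoidal, so $f^*\mathbf 1_Y\simeq\mathbf 1_X$. Recollement axioms for a closed immersion $i:Z\hookrightarrow X$ with open complement $j:U=X\setminus Z\hookrightarrow X$: adjunctions $i^*\dashv i_*\dashv i^!$ and $j_!\dashv j^*\dashv j_*$; $i_*$ and $j_!$ are fully faithful; $j^*i_*=0$ and $i^*j_!=0$; and for each $M\in\mathcal C(X)$ functorial distinguished triangles $j_!j^*M\to M\to i_*i^*M\xrightarrow{+1}$ and $i_*i^!M\to M\to j_*j^*M\xrightarrow{+1}$, whose maps to and from $M$ are the adjunction counits and units. Definitions: $H^d(X;A)=\mathrm{Hom}_{\mathcal C(X)}(\mathbf 1_X,A[d])$; $H_Z^d(X;A)=\mathrm{Hom}_{\mathcal C(X)}(\mathbf 1_X,i_*i^!A[d])$; $\mathrm{forg}:H_Z^d(X;A)\to H^d(X;A)$ is induced by the counit $i_*i^!A\to A$. Applying $\mathrm{Hom}(\mathbf 1_X,-)$ to $i_*i^!A\to A\to j_*j^*A\xrightarrow{+1}$, and using $\mathrm{Hom}(\mathbf 1_X,j_*j^*A[d])\cong H^d(U;j^*A)$, gives the localisation long exact sequence $\cdots\to H_Z^d(X;A)\xrightarrow{\mathrm{forg}}H^d(X;A)\xrightarrow{j^*}H^d(U;j^*A)\xrightarrow{\delta}H_Z^{d+1}(X;A)\to\cdots$,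 which defines $j^*$ and $\delta$. The set of supported refinements of $c$ is $\mathrm{Lift}_Z^d(c)=\{\widetilde c\in H_Z^d(X;A)\mid\mathrm{forg}(\widetilde c)=c\}$. The translation (action) groupoid of a group $G$ acting on a set $S$ has object set $S$, and morphisms $s\to s'$ are the elements of $G$ carrying $s$ to $s'$. *)

theory Defs
  imports "HOL-Algebra.Group_Action"
begin

section \<open>Categories, functors, adjunctions\<close>

record ('o, 'm) category =
  Obj :: "'o set"
  Arr :: "'m set"
  Dom :: "'m \<Rightarrow> 'o"
  Cod :: "'m \<Rightarrow> 'o"
  Ident :: "'o \<Rightarrow> 'm"
  Comp :: "'m \<Rightarrow> 'm \<Rightarrow> 'm"  (infixl \<open>\<cdot>\<index>\<close> 70)

definition Hom :: "('o, 'm, 'e) category_scheme \<Rightarrow> 'o \<Rightarrow> 'o \<Rightarrow> 'm set" where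
  "Hom C A B = {f \<in> Arr C. Dom C f = A \<and> Cod C f = B}"

locale category =
  fixes C :: "('o, 'm, 'e) category_scheme" (structure)
  assumes Dom_closed: "f \<in> Arr C \<Longrightarrow> Dom C f \<in> Obj C"
    and Cod_closed: "f \<in> Arr C \<Longrightarrow> Cod C f \<in> Obj C"
    and Ident_in_Hom: "A \<in> Obj C \<Longrightarrow> Ident C A \<in> Hom C A A"
    and Comp_in_Hom: "\<lbrakk>f \<in> Hom C A B; g \<in> Hom C B D\<rbrakk> \<Longrightarrow> g \<cdot> f \<in> Hom C A D"
    and Ident_left: "f \<in> Hom C A B \<Longrightarrow> Ident C B \<cdot> f = f"
    and Ident_right: "f \<in> Hom C A B \<Longrightarrow> f \<cdot> Ident C A = f"
    and Comp_assoc: "\<lbrakk>f \<in> Hom C A B; g \<in> Hom C B D; h \<in> Hom C D E\<rbrakk>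
      \<Longrightarrow> (h \<cdot> g) \<cdot> f = h \<cdot> (g \<cdot> f)"

definition inverse_arrows :: "('o, 'm, 'e) category_scheme \<Rightarrow> 'm \<Rightarrow> 'm \<Rightarrow> bool" where
  "inverse_arrows C f g \<longleftrightarrow> f \<in> Arr C \<and> g \<in> Hom C (Cod C f) (Dom C f) \<and>
     g \<cdot>\<^bsub>C\<^esub> f = Ident C (Dom C f) \<and> f \<cdot>\<^bsub>C\<^esub> g = Ident C (Cod C f)"

definition iso_arrow :: "('o, 'm, 'e) category_scheme \<Rightarrow> 'm \<Rightarrow> bool" where
  "iso_arrow C f \<longleftrightarrow> (\<exists>g. inverse_arrows C f g)"

definition inv_arrow :: "('o, 'm, 'e) category_scheme \<Rightarrow> 'm \<Rightarrow> 'm" where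
  "inv_arrow C f = (THE g. inverse_arrows C f g)"

definition zero_object :: "('o, 'm, 'e) category_scheme \<Rightarrow> 'o \<Rightarrow> bool" where
  "zero_object C Z \<longleftrightarrow> Z \<in> Obj C \<and>
     (\<forall>A\<in>Obj C. (\<exists>!f. f \<in> Hom C A Z) \<and> (\<exists>!f. f \<in> Hom C Z A))"

record ('o, 'm, 'p, 'n) func =
  FObj :: "'o \<Rightarrow> 'p"
  FArr :: "'m \<Rightarrow> 'n"

definition is_functor ::
  "('o, 'm, 'e) category_scheme \<Rightarrow> ('p, 'n, 'e1) category_scheme \<Rightarrow>
   ('o, 'm, 'p, 'n, 'e2) func_scheme \<Rightarrow> bool" where
  "is_functor C D F \<longleftrightarrow>
     (\<forall>A\<in>Obj C. FObj F A \<in> Obj D) \<and>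
     (\<forall>f\<in>Arr C. FArr F f \<in> Hom D (FObj F (Dom C f)) (FObj F (Cod C f))) \<and>
     (\<forall>A\<in>Obj C. FArr F (Ident C A) = Ident D (FObj F A)) \<and>
     (\<forall>f\<in>Arr C. \<forall>g\<in>Arr C. Dom C g = Cod C f \<longrightarrow>
        FArr F (g \<cdot>\<^bsub>C\<^esub> f) = FArr F g \<cdot>\<^bsub>D\<^esub> FArr F f)"

definition id_func :: "('o, 'm, 'o, 'm) func" where
  "id_func = \<lparr>FObj = (\<lambda>A. A), FArr = (\<lambda>f. f)\<rparr>"

definition comp_func ::
  "('p, 'n, 'q, 'l, 'e1) func_scheme \<Rightarrow> ('o, 'm, 'p, 'n, 'e2) func_scheme \<Rightarrow>
   ('o, 'm, 'q, 'l) func" where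
  "comp_func G F = \<lparr>FObj = (\<lambda>A. FObj G (FObj F A)), FArr = (\<lambda>f. FArr G (FArr F f))\<rparr>"

definition nat_trans ::
  "('o, 'm, 'e) category_scheme \<Rightarrow> ('p, 'n, 'e1) category_scheme \<Rightarrow>
   ('o, 'm, 'p, 'n, 'e2) func_scheme \<Rightarrow> ('o, 'm, 'p, 'n, 'e3) func_scheme \<Rightarrow>
   ('o \<Rightarrow> 'n) \<Rightarrow> bool" where
  "nat_trans C D F G \<tau> \<longleftrightarrow>
     (\<forall>A\<in>Obj C. \<tau> A \<in> Hom D (FObj F A) (FObj G A)) \<and>
     (\<forall>f\<in>Arr C. \<tau> (Cod C f) \<cdot>\<^bsub>D\<^esub> FArr F f = FArr G f \<cdot>\<^bsub>D\<^esub> \<tau> (Dom C f))"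

definition nat_iso ::
  "('o, 'm, 'e) category_scheme \<Rightarrow> ('p, 'n, 'e1) category_scheme \<Rightarrow>
   ('o, 'm, 'p, 'n, 'e2) func_scheme \<Rightarrow> ('o, 'm, 'p, 'n, 'e3) func_scheme \<Rightarrow>
   ('o \<Rightarrow> 'n) \<Rightarrow> bool" where
  "nat_iso C D F G \<tau> \<longleftrightarrow> nat_trans C D F G \<tau> \<and> (\<forall>A\<in>Obj C. iso_arrow D (\<tau> A))"

definition is_equivalence ::
  "('o, 'm, 'e) category_scheme \<Rightarrow> ('p, 'n, 'e1) category_scheme \<Rightarrow>
   ('o, 'm, 'p, 'n, 'e2) func_scheme \<Rightarrow> bool" where
  "is_equivalence C D F \<longleftrightarrow> is_functor C D F \<and>
     (\<exists>(G :: ('p, 'n, 'o, 'm) func) \<eta> \<epsilon>. is_functor D C G \<and>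
        nat_iso C C id_func (comp_func G F) \<eta> \<and> nat_iso D D (comp_func F G) id_func \<epsilon>)"

definition equivalent_categories ::
  "('o, 'm, 'e) category_scheme \<Rightarrow> ('p, 'n, 'e1) category_scheme \<Rightarrow> bool" where
  "equivalent_categories C D \<longleftrightarrow> (\<exists>F :: ('o, 'm, 'p, 'n) func. is_equivalence C D F)"

text \<open>\<open>F : C \<rightarrow> D\<close> is left adjoint to \<open>G : D \<rightarrow> C\<close>, with unit \<open>\<eta>\<close> and counit \<open>\<epsilon>\<close>.\<close>

definition adjunction ::
  "('o, 'm, 'e) category_scheme \<Rightarrow> ('p, 'n, 'e1) category_scheme \<Rightarrow>
   ('o, 'm, 'p, 'n, 'e2) func_scheme \<Rightarrow> ('p, 'n, 'o, 'm, 'e3) func_scheme \<Rightarrow>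
   ('o \<Rightarrow> 'm) \<Rightarrow> ('p \<Rightarrow> 'n) \<Rightarrow> bool" where
  "adjunction C D F G \<eta> \<epsilon> \<longleftrightarrow>
     is_functor C D F \<and> is_functor D C G \<and>
     nat_trans C C id_func (comp_func G F) \<eta> \<and>
     nat_trans D D (comp_func F G) id_func \<epsilon> \<and>
     (\<forall>A\<in>Obj C. \<epsilon> (FObj F A) \<cdot>\<^bsub>D\<^esub> FArr F (\<eta> A) = Ident D (FObj F A)) \<and>
     (\<forall>B\<in>Obj D. FArr G (\<epsilon> B) \<cdot>\<^bsub>C\<^esub> \<eta> (FObj G B) = Ident C (FObj G B))"

definition fully_faithful ::
  "('o, 'm, 'e) category_scheme \<Rightarrow> ('p, 'n, 'e1) category_scheme \<Rightarrow>
   ('o, 'm, 'p, 'n, 'e2) func_scheme \<Rightarrow> bool" where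
  "fully_faithful C D F \<longleftrightarrow> is_functor C D F \<and>
     (\<forall>A\<in>Obj C. \<forall>B\<in>Obj C. bij_betw (FArr F) (Hom C A B) (Hom D (FObj F A) (FObj F B)))"

section \<open>Groupoids\<close>

locale groupoid = category +
  assumes all_iso: "f \<in> Arr C \<Longrightarrow> iso_arrow C f"

definition connected_groupoid :: "('o, 'm, 'e) category_scheme \<Rightarrow> bool" where
  "connected_groupoid C \<longleftrightarrow> groupoid C \<and> Obj C \<noteq> {} \<and>
     (\<forall>A\<in>Obj C. \<forall>B\<in>Obj C. Hom C A B \<noteq> {})"

definition terminal_groupoid :: "(unit, unit) category" where
  "terminal_groupoid =
     \<lparr>Obj = {()}, Arr = {()}, Dom = (\<lambda>_. ()), Cod = (\<lambda>_. ()),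
      Ident = (\<lambda>_. ()), Comp = (\<lambda>_ _. ())\<rparr>"

text \<open>A morphism \<open>s \<rightarrow> s'\<close> of the translation groupoid is a group element carrying \<open>s\<close> to
  \<open>s'\<close>; it is stored together with its source and target so that hom-sets are disjoint.\<close>

definition translation_groupoid ::
  "('g, 'e) monoid_scheme \<Rightarrow> 's set \<Rightarrow> ('g \<Rightarrow> 's \<Rightarrow> 's) \<Rightarrow> ('s, 's \<times> 'g \<times> 's) category" where
  "translation_groupoid G S \<phi> =
     \<lparr>Obj = S,
      Arr = {(s, g, s'). s \<in> S \<and> g \<in> carrier G \<and> s' \<in> S \<and> \<phi> g s = s'},
      Dom = (\<lambda>(s, g, s'). s),
      Cod = (\<lambda>(s, g, s'). s'),
      Ident = (\<lambda>s. (s, \<one>\<^bsub>G\<^esub>, s)),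
      Comp = (\<lambda>(t, h, t') (s, g, s'). (s, h \<otimes>\<^bsub>G\<^esub> g, t'))\<rparr>"

section \<open>Triangulated categories\<close>

record ('o, 'm) additive_category = "('o, 'm) category" +
  Plus :: "'m \<Rightarrow> 'm \<Rightarrow> 'm"  (infixl \<open>\<boxplus>\<index>\<close> 65)
  ZeroArr :: "'o \<Rightarrow> 'o \<Rightarrow> 'm"

text \<open>The abelian group structure on a hom-set, as a group in the sense of HOL-Algebra:
  \<open>\<otimes>\<close> is addition of morphisms and \<open>\<one>\<close> is the zero morphism.\<close>

definition Hom_group ::
  "('o, 'm, 'e) additive_category_scheme \<Rightarrow> 'o \<Rightarrow> 'o \<Rightarrow> 'm monoid" where
  "Hom_group C A B = \<lparr>carrier = Hom C A B, monoid.mult = Plus C, one = ZeroArr C A B\<rparr>"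

definition Neg :: "('o, 'm, 'e) additive_category_scheme \<Rightarrow> 'm \<Rightarrow> 'm" where
  "Neg C f = inv\<^bsub>Hom_group C (Dom C f) (Cod C f)\<^esub> f"

locale additive_category = category C
  for C :: "('o, 'm, 'e) additive_category_scheme" (structure) +
  assumes Hom_comm_group: "\<lbrakk>A \<in> Obj C; B \<in> Obj C\<rbrakk> \<Longrightarrow> comm_group (Hom_group C A B)"
    and Comp_Plus_right: "\<lbrakk>f \<in> Hom C A B; g \<in> Hom C A B; h \<in> Hom C B D\<rbrakk>
      \<Longrightarrow> h \<cdot> (f \<boxplus> g) = (h \<cdot> f) \<boxplus> (h \<cdot> g)"
    and Comp_Plus_left: "\<lbrakk>h \<in> Hom C A B; f \<in> Hom C B D; g \<in> Hom C B D\<rbrakk>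
      \<Longrightarrow> (f \<boxplus> g) \<cdot> h = (f \<cdot> h) \<boxplus> (g \<cdot> h)"
    and zero_object_exists: "\<exists>Z. zero_object C Z"
    and biproduct_exists: "\<lbrakk>A \<in> Obj C; B \<in> Obj C\<rbrakk> \<Longrightarrow>
      \<exists>P\<in>Obj C. \<exists>i\<^sub>1\<in>Hom C A P. \<exists>i\<^sub>2\<in>Hom C B P. \<exists>p\<^sub>1\<in>Hom C P A. \<exists>p\<^sub>2\<in>Hom C P B.
        p\<^sub>1 \<cdot> i\<^sub>1 = Ident C A \<and> p\<^sub>2 \<cdot> i\<^sub>2 = Ident C B \<and>
        p\<^sub>1 \<cdot> i\<^sub>2 = ZeroArr C B A \<and> p\<^sub>2 \<cdot> i\<^sub>1 = ZeroArr C A B \<and>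
        (i\<^sub>1 \<cdot> p\<^sub>1) \<boxplus> (i\<^sub>2 \<cdot> p\<^sub>2) = Ident C P"

definition additive_functor ::
  "('o, 'm, 'e) additive_category_scheme \<Rightarrow> ('p, 'n, 'e1) additive_category_scheme \<Rightarrow>
   ('o, 'm, 'p, 'n, 'e2) func_scheme \<Rightarrow> bool" where
  "additive_functor C D F \<longleftrightarrow> is_functor C D F \<and>
     (\<forall>f\<in>Arr C. \<forall>g\<in>Arr C. Dom C f = Dom C g \<and> Cod C f = Cod C g \<longrightarrow>
        FArr F (f \<boxplus>\<^bsub>C\<^esub> g) = FArr F f \<boxplus>\<^bsub>D\<^esub> FArr F g)"

text \<open>\<open>ShiftObj C n A\<close> is \<open>A[n]\<close>. As usual for triangulated categories the translations are
  strict: \<open>A[0] = A\<close> and \<open>A[m][n] = A[m + n]\<close>. A triple \<open>(f, g, h) \<in> Dist C\<close> is a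
  distinguished triangle \<open>X \<rightarrow> Y \<rightarrow> Z \<rightarrow> X[1]\<close>.\<close>

record ('o, 'm) triangulated_category = "('o, 'm) additive_category" +
  ShiftObj :: "int \<Rightarrow> 'o \<Rightarrow> 'o"
  ShiftArr :: "int \<Rightarrow> 'm \<Rightarrow> 'm"
  Dist :: "('m \<times> 'm \<times> 'm) set"

definition shift_func :: "('o, 'm, 'e) triangulated_category_scheme \<Rightarrow> int \<Rightarrow> ('o, 'm, 'o, 'm) func" where
  "shift_func C n = \<lparr>FObj = ShiftObj C n, FArr = ShiftArr C n\<rparr>"

definition triangle ::
  "('o, 'm, 'e) triangulated_category_scheme \<Rightarrow> 'o \<Rightarrow> 'o \<Rightarrow> 'o \<Rightarrow> 'm \<Rightarrow> 'm \<Rightarrow> 'm \<Rightarrow> bool" where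
  "triangle C X Y Z f g h \<longleftrightarrow>
     X \<in> Obj C \<and> Y \<in> Obj C \<and> Z \<in> Obj C \<and>
     f \<in> Hom C X Y \<and> g \<in> Hom C Y Z \<and> h \<in> Hom C Z (ShiftObj C 1 X)"

definition dist_triangle ::
  "('o, 'm, 'e) triangulated_category_scheme \<Rightarrow> 'o \<Rightarrow> 'o \<Rightarrow> 'o \<Rightarrow> 'm \<Rightarrow> 'm \<Rightarrow> 'm \<Rightarrow> bool" where
  "dist_triangle C X Y Z f g h \<longleftrightarrow> triangle C X Y Z f g h \<and> (f, g, h) \<in> Dist C"

locale triangulated_category = additive_category C
  for C :: "('o, 'm, 'e) triangulated_category_scheme" (structure) +
  assumes shift_additive: "additive_functor C C (shift_func C n)"
    and shift_zero_Obj: "A \<in> Obj C \<Longrightarrow> ShiftObj C 0 A = A"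
    and shift_zero_Arr: "f \<in> Arr C \<Longrightarrow> ShiftArr C 0 f = f"
    and shift_add_Obj: "A \<in> Obj C \<Longrightarrow> ShiftObj C n (ShiftObj C m A) = ShiftObj C (m + n) A"
    and shift_add_Arr: "f \<in> Arr C \<Longrightarrow> ShiftArr C n (ShiftArr C m f) = ShiftArr C (m + n) f"
    and Dist_triangle: "(f, g, h) \<in> Dist C \<Longrightarrow> \<exists>X Y Z. triangle C X Y Z f g h"
    and TR1_iso: "\<lbrakk>dist_triangle C X Y Z f g h; triangle C X' Y' Z' f' g' h';
        a \<in> Hom C X X'; b \<in> Hom C Y Y'; e \<in> Hom C Z Z';
        iso_arrow C a; iso_arrow C b; iso_arrow C e;
        b \<cdot> f = f' \<cdot> a; e \<cdot> g = g' \<cdot> b; ShiftArr C 1 a \<cdot> h = h' \<cdot> e\<rbrakk>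
      \<Longrightarrow> dist_triangle C X' Y' Z' f' g' h'"
    and TR1_Ident: "\<lbrakk>X \<in> Obj C; zero_object C Z\<rbrakk> \<Longrightarrow>
        dist_triangle C X X Z (Ident C X) (ZeroArr C X Z) (ZeroArr C Z (ShiftObj C 1 X))"
    and TR1_cone: "\<lbrakk>X \<in> Obj C; Y \<in> Obj C; f \<in> Hom C X Y\<rbrakk>
      \<Longrightarrow> \<exists>Z g h. dist_triangle C X Y Z f g h"
    and TR2: "triangle C X Y Z f g h \<Longrightarrow>
        dist_triangle C X Y Z f g h \<longleftrightarrow>
        dist_triangle C Y Z (ShiftObj C 1 X) g h (Neg C (ShiftArr C 1 f))"
    and TR3: "\<lbrakk>dist_triangle C X Y Z f g h; dist_triangle C X' Y' Z' f' g' h';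
        a \<in> Hom C X X'; b \<in> Hom C Y Y'; b \<cdot> f = f' \<cdot> a\<rbrakk>
      \<Longrightarrow> \<exists>e\<in>Hom C Z Z'. e \<cdot> g = g' \<cdot> b \<and> ShiftArr C 1 a \<cdot> h = h' \<cdot> e"
    and TR4: "\<lbrakk>dist_triangle C X Y Q\<^sub>1 f p\<^sub>1 d\<^sub>1; dist_triangle C X Z Q\<^sub>2 (g \<cdot> f) p\<^sub>2 d\<^sub>2;
        dist_triangle C Y Z Q\<^sub>3 g p\<^sub>3 d\<^sub>3\<rbrakk>
      \<Longrightarrow> \<exists>a\<in>Hom C Q\<^sub>1 Q\<^sub>2. \<exists>b\<in>Hom C Q\<^sub>2 Q\<^sub>3.
            dist_triangle C Q\<^sub>1 Q\<^sub>2 Q\<^sub>3 a b (ShiftArr C 1 p\<^sub>1 \<cdot> d\<^sub>3) \<and>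
            a \<cdot> p\<^sub>1 = p\<^sub>2 \<cdot> g \<and> d\<^sub>2 \<cdot> a = d\<^sub>1 \<and>
            b \<cdot> p\<^sub>2 = p\<^sub>3 \<and> d\<^sub>3 \<cdot> b = ShiftArr C 1 f \<cdot> d\<^sub>2"

text \<open>An exact functor carries an isomorphism \<open>F(A[1]) \<cong> F(A)[1]\<close>, natural in \<open>A\<close>, as part of
  its data.\<close>

record ('o, 'm, 'p, 'n) exact_func = "('o, 'm, 'p, 'n) func" +
  FShift :: "'o \<Rightarrow> 'n"

definition exact_functor ::
  "('o, 'm, 'e) triangulated_category_scheme \<Rightarrow> ('p, 'n, 'e1) triangulated_category_scheme \<Rightarrow>
   ('o, 'm, 'p, 'n, 'e2) exact_func_scheme \<Rightarrow> bool" where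
  "exact_functor C D F \<longleftrightarrow> additive_functor C D F \<and>
     nat_iso C D (comp_func F (shift_func C 1)) (comp_func (shift_func D 1) F) (FShift F) \<and>
     (\<forall>X Y Z f g h. dist_triangle C X Y Z f g h \<longrightarrow>
        dist_triangle D (FObj F X) (FObj F Y) (FObj F Z)
          (FArr F f) (FArr F g) (FShift F X \<cdot>\<^bsub>D\<^esub> FArr F h))"

text \<open>The comparison \<open>F(A[n]) \<rightarrow> F(A)[n]\<close> induced by the one for \<open>n = 1\<close>: iterate it for
  \<open>n \<ge> 0\<close>; for \<open>n = -k < 0\<close> take the inverse of the \<open>(-k)\<close>-fold translate of
  \<open>F(A) = F(A[-k][k]) \<rightarrow> F(A[-k])[k]\<close>.\<close>

primrec shift_comparison_nat ::
  "('o, 'm, 'e) triangulated_category_scheme \<Rightarrow> ('p, 'n, 'e1) triangulated_category_scheme \<Rightarrow>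
   ('o, 'm, 'p, 'n, 'e2) exact_func_scheme \<Rightarrow> nat \<Rightarrow> 'o \<Rightarrow> 'n" where
  "shift_comparison_nat C D F 0 A = Ident D (FObj F A)"
| "shift_comparison_nat C D F (Suc k) A =
     ShiftArr D 1 (shift_comparison_nat C D F k A) \<cdot>\<^bsub>D\<^esub> FShift F (ShiftObj C (int k) A)"

definition shift_comparison ::
  "('o, 'm, 'e) triangulated_category_scheme \<Rightarrow> ('p, 'n, 'e1) triangulated_category_scheme \<Rightarrow>
   ('o, 'm, 'p, 'n, 'e2) exact_func_scheme \<Rightarrow> int \<Rightarrow> 'o \<Rightarrow> 'n" where
  "shift_comparison C D F n A =
     (if 0 \<le> n then shift_comparison_nat C D F (nat n) A
      else inv_arrow D (ShiftArr D n (shift_comparison_nat C D F (nat (- n)) (ShiftObj C n A))))"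

section \<open>Symmetric monoidal structures\<close>

record ('o, 'm) sm_triangulated_category = "('o, 'm) triangulated_category" +
  TensorObj :: "'o \<Rightarrow> 'o \<Rightarrow> 'o"  (infixr \<open>\<otimes>o\<index>\<close> 75)
  TensorArr :: "'m \<Rightarrow> 'm \<Rightarrow> 'm"  (infixr \<open>\<otimes>a\<index>\<close> 75)
  Unit :: 'o
  Assoc :: "'o \<Rightarrow> 'o \<Rightarrow> 'o \<Rightarrow> 'm"
  LUnit :: "'o \<Rightarrow> 'm"
  RUnit :: "'o \<Rightarrow> 'm"
  Braid :: "'o \<Rightarrow> 'o \<Rightarrow> 'm"

locale symmetric_monoidal_category = category C
  for C :: "('o, 'm, 'e) sm_triangulated_category_scheme" (structure) +
  assumes TensorObj_closed: "\<lbrakk>A \<in> Obj C; B \<in> Obj C\<rbrakk> \<Longrightarrow> A \<otimes>o B \<in> Obj C"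
    and TensorArr_closed: "\<lbrakk>f \<in> Hom C A A'; g \<in> Hom C B B'\<rbrakk>
      \<Longrightarrow> f \<otimes>a g \<in> Hom C (A \<otimes>o B) (A' \<otimes>o B')"
    and Tensor_Ident: "\<lbrakk>A \<in> Obj C; B \<in> Obj C\<rbrakk> \<Longrightarrow> Ident C A \<otimes>a Ident C B = Ident C (A \<otimes>o B)"
    and Tensor_Comp: "\<lbrakk>f \<in> Hom C A A'; f' \<in> Hom C A' A''; g \<in> Hom C B B'; g' \<in> Hom C B' B''\<rbrakk>
      \<Longrightarrow> (f' \<cdot> f) \<otimes>a (g' \<cdot> g) = (f' \<otimes>a g') \<cdot> (f \<otimes>a g)"
    and Unit_closed: "Unit C \<in> Obj C"
    and Assoc_in_Hom: "\<lbrakk>A \<in> Obj C; B \<in> Obj C; D \<in> Obj C\<rbrakk>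
      \<Longrightarrow> Assoc C A B D \<in> Hom C ((A \<otimes>o B) \<otimes>o D) (A \<otimes>o (B \<otimes>o D))"
    and Assoc_iso: "\<lbrakk>A \<in> Obj C; B \<in> Obj C; D \<in> Obj C\<rbrakk> \<Longrightarrow> iso_arrow C (Assoc C A B D)"
    and Assoc_natural: "\<lbrakk>f \<in> Hom C A A'; g \<in> Hom C B B'; h \<in> Hom C D D'\<rbrakk>
      \<Longrightarrow> Assoc C A' B' D' \<cdot> ((f \<otimes>a g) \<otimes>a h) = (f \<otimes>a (g \<otimes>a h)) \<cdot> Assoc C A B D"
    and LUnit_in_Hom: "A \<in> Obj C \<Longrightarrow> LUnit C A \<in> Hom C (Unit C \<otimes>o A) A"
    and LUnit_iso: "A \<in> Obj C \<Longrightarrow> iso_arrow C (LUnit C A)"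
    and LUnit_natural: "f \<in> Hom C A B
      \<Longrightarrow> LUnit C B \<cdot> (Ident C (Unit C) \<otimes>a f) = f \<cdot> LUnit C A"
    and RUnit_in_Hom: "A \<in> Obj C \<Longrightarrow> RUnit C A \<in> Hom C (A \<otimes>o Unit C) A"
    and RUnit_iso: "A \<in> Obj C \<Longrightarrow> iso_arrow C (RUnit C A)"
    and RUnit_natural: "f \<in> Hom C A B
      \<Longrightarrow> RUnit C B \<cdot> (f \<otimes>a Ident C (Unit C)) = f \<cdot> RUnit C A"
    and Braid_in_Hom: "\<lbrakk>A \<in> Obj C; B \<in> Obj C\<rbrakk> \<Longrightarrow> Braid C A B \<in> Hom C (A \<otimes>o B) (B \<otimes>o A)"
    and Braid_natural: "\<lbrakk>f \<in> Hom C A A'; g \<in> Hom C B B'\<rbrakk>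
      \<Longrightarrow> Braid C A' B' \<cdot> (f \<otimes>a g) = (g \<otimes>a f) \<cdot> Braid C A B"
    and pentagon: "\<lbrakk>A \<in> Obj C; B \<in> Obj C; D \<in> Obj C; E \<in> Obj C\<rbrakk>
      \<Longrightarrow> Assoc C A B (D \<otimes>o E) \<cdot> Assoc C (A \<otimes>o B) D E =
          (Ident C A \<otimes>a Assoc C B D E) \<cdot> Assoc C A (B \<otimes>o D) E \<cdot> (Assoc C A B D \<otimes>a Ident C E)"
    and unit_triangle: "\<lbrakk>A \<in> Obj C; B \<in> Obj C\<rbrakk>
      \<Longrightarrow> (Ident C A \<otimes>a LUnit C B) \<cdot> Assoc C A (Unit C) B = RUnit C A \<otimes>a Ident C B"
    and hexagon: "\<lbrakk>A \<in> Obj C; B \<in> Obj C; D \<in> Obj C\<rbrakk>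
      \<Longrightarrow> Assoc C B D A \<cdot> Braid C A (B \<otimes>o D) \<cdot> Assoc C A B D =
          (Ident C B \<otimes>a Braid C A D) \<cdot> Assoc C B A D \<cdot> (Braid C A B \<otimes>a Ident C D)"
    and Braid_symmetric: "\<lbrakk>A \<in> Obj C; B \<in> Obj C\<rbrakk>
      \<Longrightarrow> Braid C B A \<cdot> Braid C A B = Ident C (A \<otimes>o B)"

locale sm_triangulated_category = triangulated_category C + symmetric_monoidal_category C
  for C :: "('o, 'm, 'e) sm_triangulated_category_scheme" (structure)

text \<open>Structure isomorphisms \<open>FUnit : \<one> \<rightarrow> F \<one>\<close> and
  \<open>FTensor A B : F A \<otimes> F B \<rightarrow> F (A \<otimes> B)\<close> of a (strong) symmetric monoidal functor.\<close>

record ('o, 'm, 'p, 'n) sm_exact_func = "('o, 'm, 'p, 'n) exact_func" +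
  FUnit :: 'n
  FTensor :: "'o \<Rightarrow> 'o \<Rightarrow> 'n"

definition symmetric_monoidal_functor ::
  "('o, 'm, 'e) sm_triangulated_category_scheme \<Rightarrow>
   ('p, 'n, 'e1) sm_triangulated_category_scheme \<Rightarrow>
   ('o, 'm, 'p, 'n, 'e2) sm_exact_func_scheme \<Rightarrow> bool" where
  "symmetric_monoidal_functor C D F \<longleftrightarrow> is_functor C D F \<and>
     FUnit F \<in> Hom D (Unit D) (FObj F (Unit C)) \<and> iso_arrow D (FUnit F) \<and>
     (\<forall>A\<in>Obj C. \<forall>B\<in>Obj C.
        FTensor F A B \<in> Hom D (FObj F A \<otimes>o\<^bsub>D\<^esub> FObj F B) (FObj F (A \<otimes>o\<^bsub>C\<^esub> B)) \<and>
        iso_arrow D (FTensor F A B)) \<and>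
     (\<forall>f\<in>Arr C. \<forall>g\<in>Arr C.
        FTensor F (Cod C f) (Cod C g) \<cdot>\<^bsub>D\<^esub> (FArr F f \<otimes>a\<^bsub>D\<^esub> FArr F g) =
        FArr F (f \<otimes>a\<^bsub>C\<^esub> g) \<cdot>\<^bsub>D\<^esub> FTensor F (Dom C f) (Dom C g)) \<and>
     (\<forall>A\<in>Obj C. \<forall>B\<in>Obj C. \<forall>E\<in>Obj C.
        FArr F (Assoc C A B E) \<cdot>\<^bsub>D\<^esub> FTensor F (A \<otimes>o\<^bsub>C\<^esub> B) E \<cdot>\<^bsub>D\<^esub>
          (FTensor F A B \<otimes>a\<^bsub>D\<^esub> Ident D (FObj F E)) =
        FTensor F A (B \<otimes>o\<^bsub>C\<^esub> E) \<cdot>\<^bsub>D\<^esub> (Ident D (FObj F A) \<otimes>a\<^bsub>D\<^esub> FTensor F B E) \<cdot>\<^bsub>D\<^esub>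
          Assoc D (FObj F A) (FObj F B) (FObj F E)) \<and>
     (\<forall>A\<in>Obj C.
        FArr F (LUnit C A) \<cdot>\<^bsub>D\<^esub> FTensor F (Unit C) A \<cdot>\<^bsub>D\<^esub>
          (FUnit F \<otimes>a\<^bsub>D\<^esub> Ident D (FObj F A)) = LUnit D (FObj F A) \<and>
        FArr F (RUnit C A) \<cdot>\<^bsub>D\<^esub> FTensor F A (Unit C) \<cdot>\<^bsub>D\<^esub>
          (Ident D (FObj F A) \<otimes>a\<^bsub>D\<^esub> FUnit F) = RUnit D (FObj F A)) \<and>
     (\<forall>A\<in>Obj C. \<forall>B\<in>Obj C.
        FArr F (Braid C A B) \<cdot>\<^bsub>D\<^esub> FTensor F A B =
        FTensor F B A \<cdot>\<^bsub>D\<^esub> Braid D (FObj F A) (FObj F B))"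

section \<open>Coefficient systems and recollement\<close>

text \<open>\<open>Sheaf S X\<close> is the category attached to the space \<open>X\<close>; \<open>Pull S f\<close> and \<open>Push S f\<close> are the
  inverse and direct image along \<open>f\<close>, with \<open>AdjUnit S f\<close> and \<open>AdjCounit S f\<close> the unit and
  counit of their adjunction. Closed immersions and the relation ``\<open>j\<close> is the open complement
  of \<open>i\<close>'' are primitive data on the category of spaces.\<close>

record ('x, 's, 'o, 'm) coefficient_system =
  Spaces :: "('x, 's) category"
  ClosedImm :: "'s set"
  OpenCompl :: "('s \<times> 's) set"
  Sheaf :: "'x \<Rightarrow> ('o, 'm) sm_triangulated_category"
  Pull :: "'s \<Rightarrow> ('o, 'm, 'o, 'm) sm_exact_func"
  Push :: "'s \<Rightarrow> ('o, 'm, 'o, 'm) exact_func"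
  AdjUnit :: "'s \<Rightarrow> 'o \<Rightarrow> 'm"
  AdjCounit :: "'s \<Rightarrow> 'o \<Rightarrow> 'm"

locale coefficient_system =
  fixes S :: "('x, 's, 'o, 'm) coefficient_system"
  assumes Spaces_category: "category (Spaces S)"
    and ClosedImm_Arr: "ClosedImm S \<subseteq> Arr (Spaces S)"
    and OpenCompl_Arr: "(i, j) \<in> OpenCompl S \<Longrightarrow>
      i \<in> ClosedImm S \<and> j \<in> Arr (Spaces S) \<and> Cod (Spaces S) i = Cod (Spaces S) j"
    and Sheaf_category: "X \<in> Obj (Spaces S) \<Longrightarrow> sm_triangulated_category (Sheaf S X)"
    and Pull_exact: "f \<in> Hom (Spaces S) X Y \<Longrightarrow> exact_functor (Sheaf S Y) (Sheaf S X) (Pull S f)"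
    and Pull_monoidal: "f \<in> Hom (Spaces S) X Y \<Longrightarrow>
      symmetric_monoidal_functor (Sheaf S Y) (Sheaf S X) (Pull S f)"
    and Push_exact: "f \<in> Hom (Spaces S) X Y \<Longrightarrow> exact_functor (Sheaf S X) (Sheaf S Y) (Push S f)"
    and Pull_Push_adjunction: "f \<in> Hom (Spaces S) X Y \<Longrightarrow>
      adjunction (Sheaf S Y) (Sheaf S X) (Pull S f) (Push S f) (AdjUnit S f) (AdjCounit S f)"

text \<open>The data of a recollement for \<open>(i, j)\<close> beyond \<open>i\<^sup>* \<stileturn> i\<^sub>*\<close> and \<open>j\<^sup>* \<stileturn> j\<^sub>*\<close>: the functors
  \<open>i\<^sup>!\<close> (\<open>UShriek\<close>) and \<open>j\<^sub>!\<close> (\<open>LShriek\<close>) with the units and counits of \<open>i\<^sub>* \<stileturn> i\<^sup>!\<close> and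
  \<open>j\<^sub>! \<stileturn> j\<^sup>*\<close>, and the third maps \<open>i\<^sub>* i\<^sup>* M \<rightarrow> j\<^sub>! j\<^sup>* M[1]\<close> (\<open>LBound\<close>) and
  \<open>j\<^sub>* j\<^sup>* M \<rightarrow> i\<^sub>* i\<^sup>! M[1]\<close> (\<open>RBound\<close>) of the two localisation triangles.\<close>

record ('o, 'm) recollement =
  UShriek :: "('o, 'm, 'o, 'm) func"
  UShriekUnit :: "'o \<Rightarrow> 'm"
  UShriekCounit :: "'o \<Rightarrow> 'm"
  LShriek :: "('o, 'm, 'o, 'm) func"
  LShriekUnit :: "'o \<Rightarrow> 'm"
  LShriekCounit :: "'o \<Rightarrow> 'm"
  LBound :: "'o \<Rightarrow> 'm"
  RBound :: "'o \<Rightarrow> 'm"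

locale recollement =
  fixes S :: "('x, 's, 'o, 'm) coefficient_system" and i j :: 's and R :: "('o, 'm) recollement"
  fixes CZ CX CU
  defines "CZ \<equiv> Sheaf S (Dom (Spaces S) i)"
    and "CX \<equiv> Sheaf S (Cod (Spaces S) i)"
    and "CU \<equiv> Sheaf S (Dom (Spaces S) j)"
  assumes UShriek_adjunction:
      "adjunction CZ CX (Push S i) (UShriek R) (UShriekUnit R) (UShriekCounit R)"
    and LShriek_adjunction:
      "adjunction CU CX (LShriek R) (Pull S j) (LShriekUnit R) (LShriekCounit R)"
    and Push_closed_ff: "fully_faithful CZ CX (Push S i)"
    and LShriek_ff: "fully_faithful CU CX (LShriek R)"
    and Pull_Push_zero: "M \<in> Obj CZ \<Longrightarrow> zero_object CU (FObj (Pull S j) (FObj (Push S i) M))"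
    and Pull_LShriek_zero: "M \<in> Obj CU \<Longrightarrow> zero_object CZ (FObj (Pull S i) (FObj (LShriek R) M))"
    and L_triangle: "M \<in> Obj CX \<Longrightarrow>
      dist_triangle CX (FObj (LShriek R) (FObj (Pull S j) M)) M (FObj (Push S i) (FObj (Pull S i) M))
        (LShriekCounit R M) (AdjUnit S i M) (LBound R M)"
    and L_triangle_natural:
      "nat_trans CX CX (comp_func (Push S i) (Pull S i))
        (comp_func (shift_func CX 1) (comp_func (LShriek R) (Pull S j))) (LBound R)"
    and R_triangle: "M \<in> Obj CX \<Longrightarrow>
      dist_triangle CX (FObj (Push S i) (FObj (UShriek R) M)) M (FObj (Push S j) (FObj (Pull S j) M))
        (UShriekCounit R M) (AdjUnit S j M) (RBound R M)"
    and R_triangle_natural: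
      "nat_trans CX CX (comp_func (Push S j) (Pull S j))
        (comp_func (shift_func CX 1) (comp_func (Push S i) (UShriek R))) (RBound R)"

section \<open>Cohomology, cohomology with supports, localisation sequence\<close>

definition cohomology ::
  "('x, 's, 'o, 'm) coefficient_system \<Rightarrow> 'x \<Rightarrow> 'o \<Rightarrow> int \<Rightarrow> 'm monoid" where
  "cohomology S X A d =
     Hom_group (Sheaf S X) (Unit (Sheaf S X)) (ShiftObj (Sheaf S X) d A)"

definition supp_cohomology ::
  "('x, 's, 'o, 'm) coefficient_system \<Rightarrow> ('o, 'm) recollement \<Rightarrow> 's \<Rightarrow> 'o \<Rightarrow> int \<Rightarrow> 'm monoid" where
  "supp_cohomology S R i A d =
     cohomology S (Cod (Spaces S) i) (FObj (Push S i) (FObj (UShriek R) A)) d"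

definition forg ::
  "('x, 's, 'o, 'm) coefficient_system \<Rightarrow> ('o, 'm) recollement \<Rightarrow> 's \<Rightarrow> 'o \<Rightarrow> int \<Rightarrow> 'm \<Rightarrow> 'm" where
  "forg S R i A d s =
     (let CX = Sheaf S (Cod (Spaces S) i) in ShiftArr CX d (UShriekCounit R A) \<cdot>\<^bsub>CX\<^esub> s)"

text \<open>For \<open>B \<in> \<C>(U)\<close>, the isomorphism \<open>Hom(\<one>\<^sub>X, (j\<^sub>* B)[d]) \<cong> H\<^sup>d(U; B)\<close>: identify
  \<open>(j\<^sub>* B)[d]\<close> with \<open>j\<^sub>*(B[d])\<close>, use \<open>j\<^sup>* \<stileturn> j\<^sub>*\<close>, and identify \<open>j\<^sup>* \<one>\<^sub>X\<close> with \<open>\<one>\<^sub>U\<close>;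
  \<open>from_open\<close> is the inverse of \<open>to_open\<close>.\<close>

definition to_open ::
  "('x, 's, 'o, 'm) coefficient_system \<Rightarrow> 's \<Rightarrow> 'o \<Rightarrow> int \<Rightarrow> 'm \<Rightarrow> 'm" where
  "to_open S j B d v =
     (let CX = Sheaf S (Cod (Spaces S) j); CU = Sheaf S (Dom (Spaces S) j) in
      AdjCounit S j (ShiftObj CU d B) \<cdot>\<^bsub>CU\<^esub>
      FArr (Pull S j) (inv_arrow CX (shift_comparison CU CX (Push S j) d B) \<cdot>\<^bsub>CX\<^esub> v) \<cdot>\<^bsub>CU\<^esub>
      FUnit (Pull S j))"

definition from_open ::
  "('x, 's, 'o, 'm) coefficient_system \<Rightarrow> 's \<Rightarrow> 'o \<Rightarrow> int \<Rightarrow> 'm \<Rightarrow> 'm" where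
  "from_open S j B d u =
     (let CX = Sheaf S (Cod (Spaces S) j); CU = Sheaf S (Dom (Spaces S) j) in
      shift_comparison CU CX (Push S j) d B \<cdot>\<^bsub>CX\<^esub>
      FArr (Push S j) (u \<cdot>\<^bsub>CU\<^esub> inv_arrow CU (FUnit (Pull S j))) \<cdot>\<^bsub>CX\<^esub>
      AdjUnit S j (Unit CX))"

text \<open>\<open>j\<^sup>* : H\<^sup>d(X; A) \<rightarrow> H\<^sup>d(U; j\<^sup>* A)\<close>.\<close>

definition restriction ::
  "('x, 's, 'o, 'm) coefficient_system \<Rightarrow> 's \<Rightarrow> 'o \<Rightarrow> int \<Rightarrow> 'm \<Rightarrow> 'm" where
  "restriction S j A d c =
     (let CX = Sheaf S (Cod (Spaces S) j) in
      to_open S j (FObj (Pull S j) A) d (ShiftArr CX d (AdjUnit S j A) \<cdot>\<^bsub>CX\<^esub> c))"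

text \<open>\<open>\<delta> : H\<^sup>e(U; j\<^sup>* A) \<rightarrow> H\<^sub>Z\<^sup>e\<^sup>+\<^sup>1(X; A)\<close>.\<close>

definition connecting ::
  "('x, 's, 'o, 'm) coefficient_system \<Rightarrow> ('o, 'm) recollement \<Rightarrow> 's \<Rightarrow> 'o \<Rightarrow> int \<Rightarrow> 'm \<Rightarrow> 'm" where
  "connecting S R j A e u =
     (let CX = Sheaf S (Cod (Spaces S) j) in
      ShiftArr CX e (RBound R A) \<cdot>\<^bsub>CX\<^esub> from_open S j (FObj (Pull S j) A) e u)"

definition Lift ::
  "('x, 's, 'o, 'm) coefficient_system \<Rightarrow> ('o, 'm) recollement \<Rightarrow> 's \<Rightarrow> 'o \<Rightarrow> int \<Rightarrow> 'm \<Rightarrow> 'm set" where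
  "Lift S R i A d c = {s \<in> carrier (supp_cohomology S R i A d). forg S R i A d s = c}"

text \<open>The group \<open>G\<^sub>Z(c)\<close>; it depends on \<open>c\<close> only through \<open>A\<close> and the degree \<open>d\<close>.\<close>

definition GZ ::
  "('x, 's, 'o, 'm) coefficient_system \<Rightarrow> ('o, 'm) recollement \<Rightarrow> 's \<Rightarrow> 'o \<Rightarrow> int \<Rightarrow> 'm set" where
  "GZ S R j A d =
     connecting S R j A (d - 1) `
       carrier (cohomology S (Dom (Spaces S) j) (FObj (Pull S j) A) (d - 1))"

text \<open>As for \<open>Hom_group\<close>, \<open>\<otimes>\<close> below is addition of cohomology classes.\<close>

definition GZ_group ::
  "('x, 's, 'o, 'm) coefficient_system \<Rightarrow> ('o, 'm) recollement \<Rightarrow> 's \<Rightarrow> 's \<Rightarrow> 'o \<Rightarrow> int \<Rightarrow> 'm monoid" where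
  "GZ_group S R i j A d = (supp_cohomology S R i A d)\<lparr>carrier := GZ S R j A d\<rparr>"

definition translation ::
  "('x, 's, 'o, 'm) coefficient_system \<Rightarrow> ('o, 'm) recollement \<Rightarrow> 's \<Rightarrow> 'o \<Rightarrow> int \<Rightarrow> 'm \<Rightarrow>
   'm \<Rightarrow> 'm \<Rightarrow> 'm" where
  "translation S R i A d c g = (\<lambda>s \<in> Lift S R i A d c. s \<otimes>\<^bsub>supp_cohomology S R i A d\<^esub> g)"

definition lift_groupoid ::
  "('x, 's, 'o, 'm) coefficient_system \<Rightarrow> ('o, 'm) recollement \<Rightarrow> 's \<Rightarrow> 's \<Rightarrow> 'o \<Rightarrow> int \<Rightarrow> 'm \<Rightarrow>
   ('m, 'm \<times> 'm \<times> 'm) category" where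
  "lift_groupoid S R i j A d c =
     translation_groupoid (GZ_group S R i j A d) (Lift S R i A d c) (translation S R i A d c)"

end

theory Submission
  imports Defs
begin

text \<open>The localisation sequence is exact, so \<open>G\<^sub>Z(c)\<close> is the kernel of \<open>forg\<close> and
  \<open>j\<^sup>*c = 0\<close> makes the fibre of \<open>forg\<close> over \<open>c\<close> nonempty. The kernel of a homomorphism acts
  simply transitively on any nonempty fibre, so the translation groupoid has exactly one
  morphism between any two objects; every functor between two nonempty categories of this
  kind is an equivalence. Exactness at \<open>H\<^sup>d(X; A)\<close> and \<open>H\<^sub>Z\<^sup>d(X; A)\<close> only needs that
  \<open>from_open\<close> is additive and right inverse to \<open>to_open\<close>.\<close>

section \<open>Categories and additive categories\<close>

context category
begin

lemma Hom_Obj: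
  assumes "f \<in> Hom C A B"
  shows "A \<in> Obj C" "B \<in> Obj C"
  using assms Dom_closed Cod_closed by (auto simp: Hom_def)

lemma inverse_arrows_Hom:
  assumes "f \<in> Hom C A B"
  shows "inverse_arrows C f g \<longleftrightarrow> g \<in> Hom C B A \<and> g \<cdot> f = Ident C A \<and> f \<cdot> g = Ident C B"
  using assms by (auto simp: inverse_arrows_def Hom_def)

lemma inverse_arrows_unique:
  assumes "inverse_arrows C f g" "inverse_arrows C f g'"
  shows "g = g'"
proof -
  have f: "f \<in> Hom C (Dom C f) (Cod C f)"
    using assms(1) by (auto simp: inverse_arrows_def Hom_def)
  note g = assms(1)[unfolded inverse_arrows_Hom[OF f]]
  note g' = assms(2)[unfolded inverse_arrows_Hom[OF f]]
  have "g = (g' \<cdot> f) \<cdot> g" using g g' Ident_left by metis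
  also have "\<dots> = g'" using Comp_assoc[of g _ _ f _ g'] f g g' Ident_right by metis
  finally show ?thesis .
qed

text \<open>\<open>inv_arrow\<close> is a definite description, so it denotes an inverse only
  because inverses are unique.\<close>

lemma inverse_arrows_inv_arrow:
  assumes "iso_arrow C f"
  shows "inverse_arrows C f (inv_arrow C f)"
proof -
  obtain g where "inverse_arrows C f g" using assms by (auto simp: iso_arrow_def)
  then show ?thesis
    unfolding inv_arrow_def by (rule theI) (metis \<open>inverse_arrows C f g\<close> inverse_arrows_unique)
qed

lemma inv_arrow:
  assumes "f \<in> Hom C A B" "iso_arrow C f"
  shows "inv_arrow C f \<in> Hom C B A" "inv_arrow C f \<cdot> f = Ident C A" "f \<cdot> inv_arrow C f = Ident C B"
  using inverse_arrows_inv_arrow[OF assms(2)] by (simp_all add: inverse_arrows_Hom[OF assms(1)])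

lemma iso_arrowI:
  assumes "f \<in> Hom C A B" "g \<in> Hom C B A" "g \<cdot> f = Ident C A" "f \<cdot> g = Ident C B"
  shows "iso_arrow C f"
  using assms by (auto simp: iso_arrow_def inverse_arrows_Hom)

lemma iso_arrow_inv:
  assumes "f \<in> Hom C A B" "iso_arrow C f"
  shows "iso_arrow C (inv_arrow C f)"
  using iso_arrowI inv_arrow[OF assms] assms(1) by blast

lemma iso_arrow_Ident: "A \<in> Obj C \<Longrightarrow> iso_arrow C (Ident C A)"
  using iso_arrowI Ident_in_Hom Ident_left by metis

lemma iso_arrow_Comp:
  assumes f: "f \<in> Hom C A B" "iso_arrow C f" and g: "g \<in> Hom C B D" "iso_arrow C g"
  shows "iso_arrow C (g \<cdot> f)"
proof -
  note f' = inv_arrow[OF f] and g' = inv_arrow[OF g]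
  let ?f = "inv_arrow C f" and ?g = "inv_arrow C g"
  have gf: "g \<cdot> f \<in> Hom C A D" and fg: "?f \<cdot> ?g \<in> Hom C D A"
    using f g f' g' Comp_in_Hom by blast+
  have "(?f \<cdot> ?g) \<cdot> (g \<cdot> f) = ?f \<cdot> ((?g \<cdot> g) \<cdot> f)"
    using Comp_assoc[OF gf g'(1) f'(1)] Comp_assoc[OF f(1) g(1) g'(1)] by simp
  then have 1: "(?f \<cdot> ?g) \<cdot> (g \<cdot> f) = Ident C A"
    using f f' g' Ident_left by simp
  have "(g \<cdot> f) \<cdot> (?f \<cdot> ?g) = g \<cdot> ((f \<cdot> ?f) \<cdot> ?g)"
    using Comp_assoc[OF fg f(1) g(1)] Comp_assoc[OF g'(1) f'(1) f(1)] by simp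
  then have 2: "(g \<cdot> f) \<cdot> (?f \<cdot> ?g) = Ident C D"
    using f' g g' Ident_left by simp
  show ?thesis by (rule iso_arrowI[OF gf fg 1 2])
qed

lemma inv_Comp_cancel:
  assumes "f \<in> Hom C A B" "iso_arrow C f" "v \<in> Hom C W B"
  shows "f \<cdot> (inv_arrow C f \<cdot> v) = v"
  using Comp_assoc[OF assms(3) inv_arrow(1)[OF assms(1,2)] assms(1)] inv_arrow(3)[OF assms(1,2)]
    Ident_left[OF assms(3)] by simp

end

section \<open>Functors, natural transformations and adjunctions\<close>

lemma functor_Obj: "is_functor C D F \<Longrightarrow> A \<in> Obj C \<Longrightarrow> FObj F A \<in> Obj D"
  by (simp add: is_functor_def)

lemma functor_Hom: "is_functor C D F \<Longrightarrow> f \<in> Hom C A B \<Longrightarrow> FArr F f \<in> Hom D (FObj F A) (FObj F B)"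
  by (auto simp: is_functor_def Hom_def)

lemma functor_Comp:
  "is_functor C D F \<Longrightarrow> f \<in> Hom C A B \<Longrightarrow> g \<in> Hom C B E
    \<Longrightarrow> FArr F (g \<cdot>\<^bsub>C\<^esub> f) = FArr F g \<cdot>\<^bsub>D\<^esub> FArr F f"
  by (auto simp: is_functor_def Hom_def)

lemma functor_Ident: "is_functor C D F \<Longrightarrow> A \<in> Obj C \<Longrightarrow> FArr F (Ident C A) = Ident D (FObj F A)"
  by (auto simp: is_functor_def)

lemma functor_iso_arrow:
  assumes "category C" "category D" "is_functor C D F" "f \<in> Hom C A B" "iso_arrow C f"
  shows "iso_arrow D (FArr F f)"
proof -
  interpret C: category C by fact
  interpret D: category D by fact
  note g = C.inv_arrow[OF assms(4,5)]
  note F = functor_Comp[OF assms(3)] functor_Ident[OF assms(3)] functor_Hom[OF assms(3)]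
  show ?thesis
    using F(1)[OF assms(4) g(1)] F(1)[OF g(1) assms(4)] F(2) g(2,3) C.Hom_Obj[OF assms(4)]
    by (intro D.iso_arrowI[OF F(3)[OF assms(4)] F(3)[OF g(1)]]) auto
qed

lemma nat_trans_naturality:
  assumes "nat_trans C D F G \<tau>" "f \<in> Hom C A B"
  shows "\<tau> B \<cdot>\<^bsub>D\<^esub> FArr F f = FArr G f \<cdot>\<^bsub>D\<^esub> \<tau> A"
  using assms by (auto simp: nat_trans_def Hom_def)

lemma nat_trans_Hom:
  "nat_trans C D F G \<tau> \<Longrightarrow> A \<in> Obj C \<Longrightarrow> \<tau> A \<in> Hom D (FObj F A) (FObj G A)"
  by (auto simp: nat_trans_def)

text \<open>The half of the adjunction bijection that will make \<open>from_open\<close> a right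
  inverse of \<open>to_open\<close>: transposing \<open>w\<close> and transposing back returns
  \<open>w\<close>. Naturality of \<eta> at \<open>w\<close> moves the unit to
  \<open>FObj G B\<close>, where the triangle identity cancels it against the counit.\<close>

lemma adjunction_transpose:
  assumes "category C" "category D" "adjunction C D F G \<eta> \<epsilon>"
    and A: "A \<in> Obj C" and B: "B \<in> Obj D" and w: "w \<in> Hom C A (FObj G B)"
  shows "\<epsilon> B \<cdot>\<^bsub>D\<^esub> FArr F w \<in> Hom D (FObj F A) B"
    and "FArr G (\<epsilon> B \<cdot>\<^bsub>D\<^esub> FArr F w) \<cdot>\<^bsub>C\<^esub> \<eta> A = w"
proof -
  interpret C: category C by fact
  interpret D: category D by fact
  have F: "is_functor C D F" and G: "is_functor D C G"
    and \<eta>: "nat_trans C C id_func (comp_func G F) \<eta>"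
    and \<epsilon>: "nat_trans D D (comp_func F G) id_func \<epsilon>"
    and tri: "FArr G (\<epsilon> B) \<cdot>\<^bsub>C\<^esub> \<eta> (FObj G B) = Ident C (FObj G B)"
    using assms(3) B by (auto simp: adjunction_def)
  have GB: "FObj G B \<in> Obj C" by (rule functor_Obj[OF G B])
  have \<epsilon>B: "\<epsilon> B \<in> Hom D (FObj F (FObj G B)) B"
    using nat_trans_Hom[OF \<epsilon> B] by (simp add: comp_func_def id_func_def)
  have \<eta>A: "\<eta> A \<in> Hom C A (FObj G (FObj F A))"
    and \<eta>GB: "\<eta> (FObj G B) \<in> Hom C (FObj G B) (FObj G (FObj F (FObj G B)))"
    using nat_trans_Hom[OF \<eta> A] nat_trans_Hom[OF \<eta> GB] by (simp_all add: comp_func_def id_func_def)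
  note Fw = functor_Hom[OF F w]
  show "\<epsilon> B \<cdot>\<^bsub>D\<^esub> FArr F w \<in> Hom D (FObj F A) B" using Fw \<epsilon>B D.Comp_in_Hom by blast
  have nat: "\<eta> (FObj G B) \<cdot>\<^bsub>C\<^esub> w = FArr G (FArr F w) \<cdot>\<^bsub>C\<^esub> \<eta> A"
    using nat_trans_naturality[OF \<eta> w] by (simp add: comp_func_def id_func_def)
  have "FArr G (\<epsilon> B \<cdot>\<^bsub>D\<^esub> FArr F w) \<cdot>\<^bsub>C\<^esub> \<eta> A = FArr G (\<epsilon> B) \<cdot>\<^bsub>C\<^esub> (\<eta> (FObj G B) \<cdot>\<^bsub>C\<^esub> w)"
    using functor_Comp[OF G Fw \<epsilon>B]
      C.Comp_assoc[OF \<eta>A functor_Hom[OF G Fw] functor_Hom[OF G \<epsilon>B]] nat by simp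
  also have "\<dots> = w"
    using C.Comp_assoc[OF w \<eta>GB functor_Hom[OF G \<epsilon>B]] tri C.Ident_left[OF w] by simp
  finally show "FArr G (\<epsilon> B \<cdot>\<^bsub>D\<^esub> FArr F w) \<cdot>\<^bsub>C\<^esub> \<eta> A = w" .
qed

section \<open>Hom-groups, signs and additive functors\<close>

lemma Hom_group_simps [simp]:
  "carrier (Hom_group C A B) = Hom C A B"
  "monoid.mult (Hom_group C A B) = Plus C"
  "one (Hom_group C A B) = ZeroArr C A B"
  by (simp_all add: Hom_group_def)

context additive_category
begin

lemma ZeroArr_in_Hom: "A \<in> Obj C \<Longrightarrow> B \<in> Obj C \<Longrightarrow> ZeroArr C A B \<in> Hom C A B"
  using monoid.one_closed[OF group.is_monoid, OF comm_group.axioms(2), OF Hom_comm_group] by simp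

lemma group_hom_Comp_left:
  assumes "A \<in> Obj C" "h \<in> Hom C B D"
  shows "group_hom (Hom_group C A B) (Hom_group C A D) (\<lambda>f. h \<cdot> f)"
  using assms Hom_Obj[OF assms(2)] Hom_comm_group Comp_in_Hom Comp_Plus_right
  by (auto intro!: group_hom.intro comm_group.axioms(2) group_hom_axioms.intro simp: hom_def)

lemma group_hom_Comp_right:
  assumes "h \<in> Hom C A B" "D \<in> Obj C"
  shows "group_hom (Hom_group C B D) (Hom_group C A D) (\<lambda>f. f \<cdot> h)"
  using assms Hom_Obj[OF assms(1)] Hom_comm_group Comp_in_Hom Comp_Plus_left
  by (auto intro!: group_hom.intro comm_group.axioms(2) group_hom_axioms.intro simp: hom_def)

lemma Comp_ZeroArr: "A \<in> Obj C \<Longrightarrow> h \<in> Hom C B D \<Longrightarrow> h \<cdot> ZeroArr C A B = ZeroArr C A D"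
  using group_hom.hom_one[OF group_hom_Comp_left] by simp

lemma ZeroArr_Comp: "h \<in> Hom C A B \<Longrightarrow> D \<in> Obj C \<Longrightarrow> ZeroArr C B D \<cdot> h = ZeroArr C A D"
  using group_hom.hom_one[OF group_hom_Comp_right] by simp

lemma Neg_Hom: "f \<in> Hom C A B \<Longrightarrow> Neg C f = inv\<^bsub>Hom_group C A B\<^esub> f"
  by (auto simp: Neg_def Hom_def)

lemma Neg_in_Hom: "f \<in> Hom C A B \<Longrightarrow> Neg C f \<in> Hom C A B"
  using group.inv_closed[OF comm_group.axioms(2)[OF Hom_comm_group], of A B f] Hom_Obj
  by (auto simp: Neg_Hom)

lemma Neg_Neg: "f \<in> Hom C A B \<Longrightarrow> Neg C (Neg C f) = f"
  using group.inv_inv[OF comm_group.axioms(2)[OF Hom_comm_group], of A B f] Hom_Obj Neg_in_Hom[of f A B]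
  by (auto simp: Neg_Hom)

lemma Neg_ZeroArr: "A \<in> Obj C \<Longrightarrow> B \<in> Obj C \<Longrightarrow> Neg C (ZeroArr C A B) = ZeroArr C A B"
  using monoid.inv_one[OF group.is_monoid, OF comm_group.axioms(2), OF Hom_comm_group, of A B]
    ZeroArr_in_Hom[of A B]
  by (simp add: Neg_Hom)

lemma Comp_Neg:
  assumes "f \<in> Hom C A B" "h \<in> Hom C B D"
  shows "h \<cdot> Neg C f = Neg C (h \<cdot> f)"
  using group_hom.hom_inv[OF group_hom_Comp_left[OF Hom_Obj(1)[OF assms(1)] assms(2)], of f] assms
    Neg_Hom[OF assms(1)] Neg_Hom[OF Comp_in_Hom[OF assms]]
  by simp

lemma Neg_Comp:
  assumes "f \<in> Hom C A B" "h \<in> Hom C B D"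
  shows "Neg C h \<cdot> f = Neg C (h \<cdot> f)"
  using group_hom.hom_inv[OF group_hom_Comp_right[OF assms(1) Hom_Obj(2)[OF assms(2)]], of h] assms
    Neg_Hom[OF assms(2)] Neg_Hom[OF Comp_in_Hom[OF assms]]
  by simp

end

lemma additive_functor_group_hom:
  assumes "additive_category C" "additive_category D" "additive_functor C D F"
    and "A \<in> Obj C" "B \<in> Obj C"
  shows "group_hom (Hom_group C A B) (Hom_group D (FObj F A) (FObj F B)) (FArr F)"
proof -
  interpret C: additive_category C by fact
  interpret D: additive_category D by fact
  have F: "is_functor C D F" using assms(3) by (simp add: additive_functor_def)
  have "FArr F \<in> hom (Hom_group C A B) (Hom_group D (FObj F A) (FObj F B))"
    using assms(3) functor_Hom[OF F] by (auto simp: hom_def additive_functor_def Hom_def)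
  then show ?thesis
    using C.Hom_comm_group D.Hom_comm_group functor_Obj[OF F] assms(4,5)
    by (auto intro!: group_hom.intro comm_group.axioms(2) group_hom_axioms.intro)
qed

lemma additive_functor_ZeroArr:
  assumes "additive_category C" "additive_category D" "additive_functor C D F"
    and "A \<in> Obj C" "B \<in> Obj C"
  shows "FArr F (ZeroArr C A B) = ZeroArr D (FObj F A) (FObj F B)"
  using group_hom.hom_one[OF additive_functor_group_hom[OF assms]] by simp

lemma additive_functor_Neg:
  assumes "additive_category C" "additive_category D" "additive_functor C D F"
    and "f \<in> Hom C A B"
  shows "FArr F (Neg C f) = Neg D (FArr F f)"
proof -
  interpret C: additive_category C by fact
  interpret D: additive_category D by fact
  have F: "is_functor C D F" using assms(3) by (simp add: additive_functor_def)
  show ?thesis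
    using group_hom.hom_inv[OF additive_functor_group_hom[OF assms(1-3) C.Hom_Obj[OF assms(4)]], of f]
      assms(4) C.Neg_Hom[OF assms(4)] D.Neg_Hom[OF functor_Hom[OF F assms(4)]] by simp
qed

section \<open>Exactness of distinguished triangles\<close>

context triangulated_category
begin

section \<open>Strict translation functors\<close>

lemma shift_functor: "is_functor C C (shift_func C n)"
  using shift_additive by (simp add: additive_functor_def)

lemma ShiftObj_closed: "A \<in> Obj C \<Longrightarrow> ShiftObj C n A \<in> Obj C"
  using functor_Obj[OF shift_functor] by (simp add: shift_func_def)

lemma ShiftArr_in_Hom: "f \<in> Hom C A B \<Longrightarrow> ShiftArr C n f \<in> Hom C (ShiftObj C n A) (ShiftObj C n B)"
  using functor_Hom[OF shift_functor] by (simp add: shift_func_def)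

lemma ShiftArr_Comp:
  "f \<in> Hom C A B \<Longrightarrow> g \<in> Hom C B D \<Longrightarrow> ShiftArr C n (g \<cdot> f) = ShiftArr C n g \<cdot> ShiftArr C n f"
  using functor_Comp[OF shift_functor] by (simp add: shift_func_def)

lemma ShiftArr_Ident: "A \<in> Obj C \<Longrightarrow> ShiftArr C n (Ident C A) = Ident C (ShiftObj C n A)"
  using functor_Ident[OF shift_functor] by (simp add: shift_func_def)

lemma ShiftArr_ZeroArr: "A \<in> Obj C \<Longrightarrow> B \<in> Obj C \<Longrightarrow>
    ShiftArr C n (ZeroArr C A B) = ZeroArr C (ShiftObj C n A) (ShiftObj C n B)"
  using additive_functor_ZeroArr[OF additive_category_axioms additive_category_axioms shift_additive]
  by (simp add: shift_func_def)

lemma ShiftArr_Neg: "f \<in> Hom C A B \<Longrightarrow> ShiftArr C n (Neg C f) = Neg C (ShiftArr C n f)"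
  using additive_functor_Neg[OF additive_category_axioms additive_category_axioms shift_additive]
  by (simp add: shift_func_def)

lemma iso_arrow_ShiftArr: "f \<in> Hom C A B \<Longrightarrow> iso_arrow C f \<Longrightarrow> iso_arrow C (ShiftArr C n f)"
  using functor_iso_arrow[OF category_axioms category_axioms shift_functor]
  by (simp add: shift_func_def)

lemma ShiftObj_cancel: "A \<in> Obj C \<Longrightarrow> ShiftObj C n (ShiftObj C (- n) A) = A"
  "A \<in> Obj C \<Longrightarrow> ShiftObj C (- n) (ShiftObj C n A) = A"
  using shift_add_Obj shift_zero_Obj by auto

lemma ShiftArr_cancel: "f \<in> Hom C A B \<Longrightarrow> ShiftArr C n (ShiftArr C (- n) f) = f"
  "f \<in> Hom C A B \<Longrightarrow> ShiftArr C (- n) (ShiftArr C n f) = f"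
  using shift_add_Arr shift_zero_Arr by (auto simp: Hom_def)

section \<open>Exact Hom-sequences of a distinguished triangle\<close>

lemma dist_triangle_Hom:
  assumes "dist_triangle C X Y Z f g h"
  shows "X \<in> Obj C" "Y \<in> Obj C" "Z \<in> Obj C"
    "f \<in> Hom C X Y" "g \<in> Hom C Y Z" "h \<in> Hom C Z (ShiftObj C 1 X)"
  using assms by (auto simp: dist_triangle_def triangle_def)

lemma dist_triangle_rotate:
  assumes "dist_triangle C X Y Z f g h"
  shows "dist_triangle C Y Z (ShiftObj C 1 X) g h (Neg C (ShiftArr C 1 f))"
  using assms TR2[of X Y Z f g h] by (simp add: dist_triangle_def)

text \<open>The identity triangle on \<open>X\<close>, with third vertex a zero object
  \<open>N\<close>, maps to the given one by \<open>Ident C X\<close> and \<open>f\<close>. The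
  third component supplied by TR3 makes \<open>g \<cdot> f\<close> factor through
  \<open>N\<close>.\<close>

lemma dist_triangle_Comp_zero:
  assumes "dist_triangle C X Y Z f g h"
  shows "g \<cdot> f = ZeroArr C X Z"
proof -
  note T = dist_triangle_Hom[OF assms]
  obtain N where N: "zero_object C N" using zero_object_exists by blast
  obtain e where "e \<in> Hom C N Z" "e \<cdot> ZeroArr C X N = g \<cdot> f"
    using TR3[OF TR1_Ident[OF T(1) N] assms Ident_in_Hom[OF T(1)] T(4) refl] by blast
  then show ?thesis using Comp_ZeroArr T(1) by metis
qed

text \<open>Exactness of Hom(W, -) at \<open>Y\<close>. TR3 produces only a third component, whereas
  a map into the first vertex is wanted, so both triangles are rotated: W -> N -> W[1] maps to Y ->
  Z -> X[1] by \<open>s\<close> and zero, and the component W[1] -> X[1] found by TR3 is translated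
  back by -1.\<close>

lemma dist_triangle_lift:
  assumes "dist_triangle C X Y Z f g h" and s: "s \<in> Hom C W Y" and 0: "g \<cdot> s = ZeroArr C W Z"
  shows "\<exists>t\<in>Hom C W X. f \<cdot> t = s"
proof -
  note T = dist_triangle_Hom[OF assms(1)]
  note W = Hom_Obj(1)[OF s]
  obtain N where N: "zero_object C N" using zero_object_exists by blast
  then have N': "N \<in> Obj C" by (simp add: zero_object_def)
  have W1: "ShiftObj C 1 W \<in> Obj C" by (rule ShiftObj_closed[OF W])
  note W_tri = dist_triangle_rotate[OF TR1_Ident[OF W N]]
  have comm: "ZeroArr C N Z \<cdot> ZeroArr C W N = g \<cdot> s"
    using 0 Comp_ZeroArr[OF W ZeroArr_in_Hom[OF N' T(3)]] by simp
  obtain e where e: "e \<in> Hom C (ShiftObj C 1 W) (ShiftObj C 1 X)"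
    and eq: "ShiftArr C 1 s \<cdot> Neg C (ShiftArr C 1 (Ident C W)) = Neg C (ShiftArr C 1 f) \<cdot> e"
    using TR3[OF W_tri dist_triangle_rotate[OF assms(1)] s ZeroArr_in_Hom[OF N' T(3)] comm] by blast
  note s1 = ShiftArr_in_Hom[OF s, of 1] and f1 = ShiftArr_in_Hom[OF T(4), of 1]
  \<comment> \<open>Each rotation puts a minus sign on the translated first map. The sign occurs on
    both sides of the square and cancels.\<close>
  have "Neg C (ShiftArr C 1 s) = Neg C (ShiftArr C 1 f \<cdot> e)"
    using eq Comp_Neg[OF Ident_in_Hom[OF W1] s1] Neg_Comp[OF e f1] Ident_right[OF s1]
    by (simp add: ShiftArr_Ident[OF W])
  then have eq1: "ShiftArr C 1 s = ShiftArr C 1 f \<cdot> e"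
    using Neg_Neg[OF s1] Neg_Neg[OF Comp_in_Hom[OF e f1]] by metis
  define t where "t = ShiftArr C (-1) e"
  have t: "t \<in> Hom C W X"
    using ShiftArr_in_Hom[OF e, of "-1"] ShiftObj_cancel(2)[of _ 1] W T(1) by (simp add: t_def)
  have "f \<cdot> t = ShiftArr C (-1) (ShiftArr C 1 s)"
    unfolding eq1 ShiftArr_Comp[OF e f1] t_def using ShiftArr_cancel(2)[OF T(4), of 1] by simp
  then show ?thesis using t ShiftArr_cancel(2)[OF s, of 1] by auto
qed

text \<open>Working with \<open>Hom(W[-n], -)\<close> on the original triangle avoids the signs of the shifted one.\<close>

lemma dist_triangle_lift_shift:
  assumes "dist_triangle C X Y Z f g h" and s: "s \<in> Hom C W (ShiftObj C n Y)"
    and 0: "ShiftArr C n g \<cdot> s = ZeroArr C W (ShiftObj C n Z)"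
  shows "\<exists>t\<in>Hom C W (ShiftObj C n X). ShiftArr C n f \<cdot> t = s"
proof -
  note T = dist_triangle_Hom[OF assms(1)]
  note W = Hom_Obj(1)[OF s]
  note gn = ShiftArr_in_Hom[OF T(5), of n]
  have s': "ShiftArr C (- n) s \<in> Hom C (ShiftObj C (- n) W) Y"
    using ShiftArr_in_Hom[OF s, of "- n"] ShiftObj_cancel(2)[OF T(2)] by simp
  have "g \<cdot> ShiftArr C (- n) s = ShiftArr C (- n) (ShiftArr C n g \<cdot> s)"
    using ShiftArr_Comp[OF s gn] ShiftArr_cancel(2)[OF T(5)] by simp
  also have "\<dots> = ZeroArr C (ShiftObj C (- n) W) Z"
    using 0 ShiftArr_ZeroArr[OF W ShiftObj_closed[OF T(3)]] ShiftObj_cancel(2)[OF T(3)] by simp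
  finally obtain t where t: "t \<in> Hom C (ShiftObj C (- n) W) X" and ft: "f \<cdot> t = ShiftArr C (- n) s"
    using dist_triangle_lift[OF assms(1) s'] by blast
  have "ShiftArr C n t \<in> Hom C W (ShiftObj C n X)"
    using ShiftArr_in_Hom[OF t, of n] ShiftObj_cancel(1)[OF W] by simp
  moreover have "ShiftArr C n f \<cdot> ShiftArr C n t = s"
    using ShiftArr_Comp[OF t T(4), of n] ft ShiftArr_cancel(1)[OF s] by simp
  ultimately show ?thesis by blast
qed

lemma ShiftObj_Suc: "A \<in> Obj C \<Longrightarrow> ShiftObj C n (ShiftObj C 1 A) = ShiftObj C (n + 1) A"
  using shift_add_Obj[of A n 1] by (simp add: add.commute)

lemma ShiftArr_Suc: "f \<in> Hom C A B \<Longrightarrow> ShiftArr C n (ShiftArr C 1 f) = ShiftArr C (n + 1) f"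
  using shift_add_Arr[of f n 1] by (simp add: add.commute Hom_def)

text \<open>Exactness at X[n+1]. After two rotations \<open>h\<close> is the first map and -f[1] the
  second, so \<open>dist_triangle_lift_shift\<close> applies. The sign does not affect whether the
  composite vanishes, and strictness identifies f[1][n] with f[n+1].\<close>

lemma dist_triangle_boundary_lift:
  assumes "dist_triangle C X Y Z f g h" and s: "s \<in> Hom C W (ShiftObj C (n + 1) X)"
    and 0: "ShiftArr C (n + 1) f \<cdot> s = ZeroArr C W (ShiftObj C (n + 1) Y)"
  shows "\<exists>t\<in>Hom C W (ShiftObj C n Z). ShiftArr C n h \<cdot> t = s"
proof -
  note T = dist_triangle_Hom[OF assms(1)]
  note rot = dist_triangle_rotate[OF dist_triangle_rotate[OF assms(1)]]
  have s': "s \<in> Hom C W (ShiftObj C n (ShiftObj C 1 X))" using s by (simp add: ShiftObj_Suc[OF T(1)])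
  have "ShiftArr C n (Neg C (ShiftArr C 1 f)) \<cdot> s = Neg C (ShiftArr C (n + 1) f \<cdot> s)"
    using ShiftArr_Neg[OF ShiftArr_in_Hom[OF T(4)]] Neg_Comp[OF s ShiftArr_in_Hom[OF T(4)]]
    by (simp add: ShiftArr_Suc[OF T(4)])
  also have "\<dots> = ZeroArr C W (ShiftObj C n (ShiftObj C 1 Y))"
    using 0 Neg_ZeroArr[OF Hom_Obj(1)[OF s] ShiftObj_closed[OF T(2)]]
    by (simp add: ShiftObj_Suc[OF T(2)])
  finally show ?thesis using dist_triangle_lift_shift[OF rot s'] by blast
qed

text \<open>In the twice rotated triangle \<open>h\<close> and -f[1] are consecutive maps. Together
  with \<open>dist_triangle_boundary_lift\<close> this identifies the image of h[n] with the kernel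
  of f[n+1].\<close>

lemma dist_triangle_boundary_zero:
  assumes "dist_triangle C X Y Z f g h"
  shows "ShiftArr C (n + 1) f \<cdot> ShiftArr C n h = ZeroArr C (ShiftObj C n Z) (ShiftObj C (n + 1) Y)"
proof -
  note T = dist_triangle_Hom[OF assms]
  note f1 = ShiftArr_in_Hom[OF T(4), of 1]
  note Y1 = ShiftObj_closed[OF T(2), of 1]
  have "Neg C (ShiftArr C 1 f) \<cdot> h = ZeroArr C Z (ShiftObj C 1 Y)"
    by (rule dist_triangle_Comp_zero[OF dist_triangle_rotate[OF dist_triangle_rotate[OF assms]]])
  then have "Neg C (ShiftArr C 1 f \<cdot> h) = Neg C (ZeroArr C Z (ShiftObj C 1 Y))"
    using Neg_Comp[OF T(6) f1] Neg_ZeroArr[OF T(3) Y1] by simp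
  then have "ShiftArr C 1 f \<cdot> h = ZeroArr C Z (ShiftObj C 1 Y)"
    using Neg_Neg[OF Comp_in_Hom[OF T(6) f1]] Neg_ZeroArr[OF T(3) Y1] by metis
  then show ?thesis
    using ShiftArr_Comp[OF T(6) f1, of n] ShiftArr_ZeroArr[OF T(3) Y1, of n]
    by (simp add: ShiftArr_Suc[OF T(4)] ShiftObj_Suc[OF T(2)])
qed

end

section \<open>Translation groupoids\<close>

text \<open>The shape shared by the terminal groupoid and the translation groupoid of a simply
  transitive action on a nonempty set, isolated so that equivalences are treated once for
  both.\<close>

definition indiscrete :: "('o, 'm, 'e) category_scheme \<Rightarrow> bool" where
  "indiscrete C \<longleftrightarrow> category C \<and> Obj C \<noteq> {} \<and> (\<forall>A\<in>Obj C. \<forall>B\<in>Obj C. \<exists>!f. f \<in> Hom C A B)"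

lemma indiscrete_Hom_eq: "indiscrete C \<Longrightarrow> f \<in> Hom C A B \<Longrightarrow> g \<in> Hom C A B \<Longrightarrow> f = g"
  unfolding indiscrete_def using category.Hom_Obj by metis

lemma indiscrete_iso_arrow:
  assumes "indiscrete C" "f \<in> Hom C A B"
  shows "iso_arrow C f"
proof -
  interpret category C using assms(1) by (simp add: indiscrete_def)
  note AB = Hom_Obj[OF assms(2)]
  obtain g where g: "g \<in> Hom C B A" using assms(1) AB unfolding indiscrete_def by blast
  show ?thesis
    using indiscrete_Hom_eq[OF assms(1)] Comp_in_Hom Ident_in_Hom assms(2) g AB
    by (intro iso_arrowI[OF assms(2) g]) blast+
qed

text \<open>The components are forced, each naturality square commutes because its two composites
  are parallel arrows in \<open>D\<close>, and every arrow of \<open>D\<close> is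
  invertible.\<close>

lemma indiscrete_nat_iso:
  assumes "category C" "indiscrete D" "is_functor C D F" "is_functor C D G"
  shows "nat_iso C D F G (\<lambda>A. THE f. f \<in> Hom D (FObj F A) (FObj G A))" (is "nat_iso C D F G ?\<tau>")
proof -
  interpret C: category C by fact
  interpret D: category D using assms(2) by (simp add: indiscrete_def)
  have \<tau>: "?\<tau> A \<in> Hom D (FObj F A) (FObj G A)" if "A \<in> Obj C" for A
    by (rule theI') (use assms(2) functor_Obj[OF assms(3) that] functor_Obj[OF assms(4) that]
        in \<open>simp add: indiscrete_def\<close>)
  have "?\<tau> (Cod C f) \<cdot>\<^bsub>D\<^esub> FArr F f = FArr G f \<cdot>\<^bsub>D\<^esub> ?\<tau> (Dom C f)" if "f \<in> Arr C" for f
  proof -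
    have f: "f \<in> Hom C (Dom C f) (Cod C f)" using that by (simp add: Hom_def)
    show ?thesis
      by (rule indiscrete_Hom_eq[OF assms(2) D.Comp_in_Hom[OF functor_Hom[OF assms(3) f]]
            D.Comp_in_Hom[OF _ functor_Hom[OF assms(4) f]]])
        (use \<tau> that C.Dom_closed C.Cod_closed in auto)
  qed
  then show ?thesis
    using \<tau> indiscrete_iso_arrow[OF assms(2)] unfolding nat_iso_def nat_trans_def by blast
qed

lemma is_functor_const:
  assumes "category D" "B \<in> Obj D"
  shows "is_functor C D \<lparr>FObj = (\<lambda>_. B), FArr = (\<lambda>_. Ident D B)\<rparr>"
  using assms category.Ident_in_Hom[OF assms] category.Ident_left[OF assms(1)]
  by (auto simp: is_functor_def)

lemma is_functor_id: "is_functor C C id_func"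
  by (auto simp: is_functor_def id_func_def Hom_def)

lemma is_functor_comp:
  assumes "is_functor C D F" "is_functor D E G"
  shows "is_functor C E (comp_func G F)"
  using assms by (auto simp: is_functor_def comp_func_def Hom_def)

text \<open>A constant functor at any object of \<open>C\<close> serves as quasi-inverse, because
  \<open>indiscrete_nat_iso\<close> yields the unit and counit for arbitrary functors.\<close>

lemma indiscrete_is_equivalence:
  fixes F :: "('o, 'm, 'p, 'n) func"
  assumes "indiscrete C" "indiscrete D" "is_functor C D F"
  shows "is_equivalence C D F"
proof -
  have C: "category C" and D: "category D" using assms(1,2) by (simp_all add: indiscrete_def)
  obtain A where A: "A \<in> Obj C" using assms(1) by (auto simp: indiscrete_def)
  let ?G = "\<lparr>FObj = (\<lambda>_. A), FArr = (\<lambda>_. Ident C A)\<rparr> :: ('p, 'n, 'o, 'm) func"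
  have G: "is_functor D C ?G" by (rule is_functor_const[OF C A])
  show ?thesis
    unfolding is_equivalence_def
    using assms(3) G
      indiscrete_nat_iso[OF C assms(1) is_functor_id is_functor_comp[OF assms(3) G]]
      indiscrete_nat_iso[OF D assms(2) is_functor_comp[OF G assms(3)] is_functor_id]
    by blast
qed

lemma indiscrete_terminal_groupoid: "indiscrete terminal_groupoid"
  by (auto simp: indiscrete_def category_def Hom_def terminal_groupoid_def)

lemma indiscrete_equivalent_terminal:
  assumes "indiscrete C"
  shows "equivalent_categories C terminal_groupoid"
  using indiscrete_is_equivalence[OF assms indiscrete_terminal_groupoid is_functor_const]
    indiscrete_terminal_groupoid
  unfolding equivalent_categories_def indiscrete_def by blast

text \<open>The only arrow of the terminal groupoid is an identity, so its image is determined by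
  the object chosen. The fields of \<open>F\<close> are functions on \<open>unit\<close>, hence
  functors that agree at \<open>()\<close> are equal as records.\<close>

lemma bij_betw_functors_from_terminal:
  fixes C :: "('o, 'm, 'e) category_scheme"
  assumes "category C"
  shows "bij_betw (\<lambda>F :: (unit, unit, 'o, 'm) func. FObj F ())
    {F. is_functor terminal_groupoid C F} (Obj C)"
proof (rule bij_betwI')
  fix F F' :: "(unit, unit, 'o, 'm) func"
  assume "F \<in> {F. is_functor terminal_groupoid C F}" "F' \<in> {F. is_functor terminal_groupoid C F}"
  then have "FArr F () = Ident C (FObj F ())" "FArr F' () = Ident C (FObj F' ())"
    by (auto simp: is_functor_def terminal_groupoid_def)
  then show "FObj F () = FObj F' () \<longleftrightarrow> F = F'"
    by (cases F, cases F') (auto simp: fun_eq_iff)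
next
  fix F :: "(unit, unit, 'o, 'm) func"
  assume "F \<in> {F. is_functor terminal_groupoid C F}"
  then show "FObj F () \<in> Obj C" by (auto simp: is_functor_def terminal_groupoid_def)
next
  fix A assume "A \<in> Obj C"
  then show "\<exists>F :: (unit, unit, 'o, 'm) func \<in> {F. is_functor terminal_groupoid C F}. A = FObj F ()"
    using is_functor_const[OF assms, of A terminal_groupoid] by force
qed

section \<open>Groupoids of group actions\<close>

lemma Obj_translation_groupoid [simp]: "Obj (translation_groupoid G E \<phi>) = E"
  by (simp add: translation_groupoid_def)

lemma Hom_translation_groupoid:
  "Hom (translation_groupoid G E \<phi>) s t = {(s, g, t) |g. s \<in> E \<and> t \<in> E \<and> g \<in> carrier G \<and> \<phi> g s = t}"
  by (auto simp: translation_groupoid_def Hom_def)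

text \<open>The action law makes composites well defined, and \<open>(t, inv g, s)\<close> is
  inverse to \<open>(s, g, t)\<close>.\<close>

lemma (in group_action) groupoid_translation_groupoid:
  "groupoid (translation_groupoid G E \<phi>)" (is "groupoid ?C")
proof -
  interpret G: group G using group_hom group_hom.axioms(1) by auto
  \<comment> \<open>The unit of \<open>BijGroup E\<close> is the identity restricted to
    \<open>E\<close>, so the equation is available only for points of \<open>E\<close>.\<close>
  have one: "\<phi> \<one> s = s" if "s \<in> E" for s using that by (simp flip: id_eq_one)
  interpret C: category ?C
    by unfold_locales
      (auto simp: Hom_translation_groupoid,
       auto simp: translation_groupoid_def one composition_rule G.m_assoc)
  show ?thesis
  proof unfold_locales
    fix f assume "f \<in> Arr ?C"
    then obtain s g t where f: "f = (s, g, t)" "s \<in> E" "t \<in> E" "g \<in> carrier G" "\<phi> g s = t"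
      by (auto simp: translation_groupoid_def)
    have g': "inv g \<in> carrier G" "\<phi> (inv g) t = s" using f orbit_sym_aux by auto
    show "iso_arrow ?C f"
    proof (rule C.iso_arrowI)
      show "f \<in> Hom ?C s t" "(t, inv g, s) \<in> Hom ?C t s"
        unfolding Hom_translation_groupoid using f g' by blast+
    qed (simp_all add: f(1,4) translation_groupoid_def)
  qed
qed

section \<open>The kernel of a homomorphism acting on a fibre\<close>

context group_hom
begin

lemma kernel_mult_fibre:
  assumes "s \<in> carrier G" "g \<in> kernel G H h"
  shows "s \<otimes> g \<in> carrier G" "h (s \<otimes> g) = h s"
  using assms by (auto simp: kernel_def)

lemma inv_mult_kernel:
  assumes "s \<in> carrier G" "t \<in> carrier G" "h s = h t"
  shows "inv s \<otimes> t \<in> kernel G H h"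
  using assms by (auto simp: kernel_def)

lemma mult_eq_iff_inv_mult:
  "\<lbrakk>s \<in> carrier G; g \<in> carrier G; t \<in> carrier G\<rbrakk> \<Longrightarrow> s \<otimes> g = t \<longleftrightarrow> g = inv s \<otimes> t"
  using G.inv_solve_left by metis

text \<open>The only candidate is \<open>inv s \<otimes> t\<close>, and it lies in the kernel
  because \<open>s\<close> and \<open>t\<close> have the same image. Existence gives transitivity of
  the action, uniqueness gives freeness.\<close>

lemma fibre_unique_translation:
  assumes "s \<in> carrier G" "t \<in> carrier G" "h s = h t"
  shows "\<exists>!g. g \<in> kernel G H h \<and> s \<otimes> g = t"
  using inv_mult_kernel[OF assms] mult_eq_iff_inv_mult[OF assms(1) _ assms(2)]
  by (auto simp: kernel_def)

text \<open>Translation by a kernel element preserves the fibres of \<open>h\<close>. Each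
  translation is restricted to its fibre because elements of \<open>BijGroup\<close> are extensional
  functions.\<close>

lemma transitive_action_fibre:
  assumes "comm_group G"
  shows "transitive_action (G\<lparr>carrier := kernel G H h\<rparr>) {s \<in> carrier G. h s = c}
    (\<lambda>g. \<lambda>s \<in> {s \<in> carrier G. h s = c}. s \<otimes> g)" (is "transitive_action ?K ?E ?\<phi>")
proof -
  interpret G: comm_group G by fact
  have K: "group ?K" by (rule subgroup.subgroup_is_group[OF subgroup_kernel G.is_group])
  have Bij: "?\<phi> g \<in> Bij ?E" if g: "g \<in> kernel G H h" for g
  proof -
    have g': "g \<in> carrier G" "h g = \<one>\<^bsub>H\<^esub>" "inv g \<in> kernel G H h"
      using g subgroup.m_inv_closed[OF subgroup_kernel] by (auto simp: kernel_def)
    \<comment> \<open>Translation by \<open>inv g\<close>, again a kernel element, is the inverse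
      map.\<close>
    have "bij_betw (?\<phi> g) ?E ?E"
      by (rule bij_betw_byWitness[where f' = "\<lambda>s. s \<otimes> inv g"])
        (use g g' kernel_mult_fibre in \<open>auto simp: G.m_assoc\<close>)
    then show ?thesis by (simp add: Bij_def)
  qed
  have "?\<phi> \<in> hom ?K (BijGroup ?E)"
  proof (rule homI)
    fix g g' assume gs: "g \<in> carrier ?K" "g' \<in> carrier ?K"
    then have gs': "g \<in> carrier G" "g' \<in> carrier G" "h g' = \<one>\<^bsub>H\<^esub>" by (auto simp: kernel_def)
    \<comment> \<open>The composite multiplies on the right by \<open>g'\<close> first and
      \<open>g\<close> second; commutativity restores the order.\<close>
    have "?\<phi> (g \<otimes> g') = compose ?E (?\<phi> g) (?\<phi> g')"
      using gs gs' kernel_mult_fibre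
      by (auto simp: compose_def fun_eq_iff restrict_def G.m_assoc G.m_comm[of g g'])
    then show "?\<phi> (g \<otimes>\<^bsub>?K\<^esub> g') = ?\<phi> g \<otimes>\<^bsub>BijGroup ?E\<^esub> ?\<phi> g'"
      using gs Bij by (simp add: BijGroup_def)
  qed (use Bij in \<open>auto simp: BijGroup_def\<close>)
  then have hom: "group_hom ?K (BijGroup ?E) ?\<phi>"
    using K by (auto intro!: group_hom.intro group_hom_axioms.intro group_BijGroup)
  show ?thesis
  proof (intro transitive_action.intro group_action.intro transitive_action_axioms.intro hom)
    fix s t assume "s \<in> ?E" "t \<in> ?E"
    then show "\<exists>g\<in>carrier ?K. ?\<phi> g s = t"
      using fibre_unique_translation[of s t] by auto
  qed
qed

end

section \<open>Cohomology of the open complement\<close>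

lemma shift_comparison_nat:
  assumes "triangulated_category C" "triangulated_category D" "exact_functor C D F" "A \<in> Obj C"
  shows "shift_comparison_nat C D F k A
      \<in> Hom D (FObj F (ShiftObj C (int k) A)) (ShiftObj D (int k) (FObj F A)) \<and>
    iso_arrow D (shift_comparison_nat C D F k A)"
proof (induction k)
  interpret C: triangulated_category C by fact
  interpret D: triangulated_category D by fact
  have F: "is_functor C D F"
    and sh: "nat_iso C D (comp_func F (shift_func C 1)) (comp_func (shift_func D 1) F) (FShift F)"
    using assms(3) by (auto simp: exact_functor_def additive_functor_def)
  note FA = functor_Obj[OF F assms(4)]
  {
    case 0
    show ?case
      using D.Ident_in_Hom[OF FA] D.iso_arrow_Ident[OF FA]
      by (simp add: C.shift_zero_Obj[OF assms(4)] D.shift_zero_Obj[OF FA])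
  next
    case (Suc k)
    let ?Ak = "ShiftObj C (int k) A"
    note Ak = C.ShiftObj_closed[OF assms(4), of "int k"]
    \<comment> \<open>The inductive step composes F(A[k][1]) -> F(A[k])[1] with the translate of the
      previous comparison. Strict translations identify the outer ends with F(A[k+1]) and
      F(A)[k+1].\<close>
    have s: "FShift F ?Ak \<in> Hom D (FObj F (ShiftObj C 1 ?Ak)) (ShiftObj D 1 (FObj F ?Ak))"
      "iso_arrow D (FShift F ?Ak)"
      using sh Ak by (auto simp: nat_iso_def nat_trans_def comp_func_def shift_func_def)
    note IH = conjunct1[OF Suc] conjunct2[OF Suc]
    note t = D.ShiftArr_in_Hom[OF IH(1), of 1] D.iso_arrow_ShiftArr[OF IH, of 1]
    show ?case
      using D.Comp_in_Hom[OF s(1) t(1)] D.iso_arrow_Comp[OF s t]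
      by (simp add: C.shift_add_Obj[OF assms(4)] D.shift_add_Obj[OF FA] add.commute)
  }
qed

lemma shift_comparison:
  assumes "triangulated_category C" "triangulated_category D" "exact_functor C D F" "A \<in> Obj C"
  shows "shift_comparison C D F n A \<in> Hom D (FObj F (ShiftObj C n A)) (ShiftObj D n (FObj F A))"
    and "iso_arrow D (shift_comparison C D F n A)"
proof -
  interpret C: triangulated_category C by fact
  interpret D: triangulated_category D by fact
  have F: "is_functor C D F" using assms(3) by (auto simp: exact_functor_def additive_functor_def)
  have "shift_comparison C D F n A \<in> Hom D (FObj F (ShiftObj C n A)) (ShiftObj D n (FObj F A)) \<and>
    iso_arrow D (shift_comparison C D F n A)"
  proof (cases "0 \<le> n")
    case True
    then show ?thesis
      using shift_comparison_nat[OF assms, of "nat n"] by (simp add: shift_comparison_def)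
  next
    case False
    \<comment> \<open>For negative \<open>n\<close> the comparison at A[n] starts at F(A[n][-n]) =
      F(A). Translating it by \<open>n\<close> gives F(A)[n] -> F(A[n]), so its inverse has the
      required direction.\<close>
    let ?A = "ShiftObj C n A"
    let ?s = "shift_comparison_nat C D F (nat (- n)) ?A"
    note A = C.ShiftObj_closed[OF assms(4), of n]
    have s: "?s \<in> Hom D (FObj F A) (ShiftObj D (- n) (FObj F ?A))" "iso_arrow D ?s"
      using shift_comparison_nat[OF assms(1-3) A, of "nat (- n)"] False
      by (simp_all add: C.ShiftObj_cancel(2)[OF assms(4)])
    have t: "ShiftArr D n ?s \<in> Hom D (ShiftObj D n (FObj F A)) (FObj F ?A)"
      "iso_arrow D (ShiftArr D n ?s)"
      using D.ShiftArr_in_Hom[OF s(1), of n] D.iso_arrow_ShiftArr[OF s, of n]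
      by (simp_all add: D.ShiftObj_cancel(1)[OF functor_Obj[OF F A]])
    show ?thesis
      using False D.inv_arrow(1)[OF t] D.iso_arrow_inv[OF t] by (simp add: shift_comparison_def)
  qed
  then show "shift_comparison C D F n A \<in> Hom D (FObj F (ShiftObj C n A)) (ShiftObj D n (FObj F A))"
    and "iso_arrow D (shift_comparison C D F n A)" by auto
qed

section \<open>Transport of cohomology along the direct image of a morphism of spaces\<close>

context coefficient_system
begin

context
  fixes j :: 's and U X :: 'x
  assumes j: "j \<in> Hom (Spaces S) U X"
begin

lemma Hom_Spaces: "Dom (Spaces S) j = U" "Cod (Spaces S) j = X" "U \<in> Obj (Spaces S)" "X \<in> Obj (Spaces S)"
  using j category.Hom_Obj[OF Spaces_category j] by (auto simp: Hom_def)

interpretation CU: sm_triangulated_category "Sheaf S U"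
  using Sheaf_category Hom_Spaces by blast

interpretation CX: sm_triangulated_category "Sheaf S X"
  using Sheaf_category Hom_Spaces by blast

lemma FUnit_Pull:
  "FUnit (Pull S j) \<in> Hom (Sheaf S U) (Unit (Sheaf S U)) (FObj (Pull S j) (Unit (Sheaf S X)))"
  "iso_arrow (Sheaf S U) (FUnit (Pull S j))"
  using Pull_monoidal[OF j] by (auto simp: symmetric_monoidal_functor_def)

lemma Push_additive: "additive_functor (Sheaf S U) (Sheaf S X) (Push S j)"
  using Push_exact[OF j] by (simp add: exact_functor_def)

lemma AdjUnit_in_Hom:
  "M \<in> Obj (Sheaf S X) \<Longrightarrow>
    AdjUnit S j M \<in> Hom (Sheaf S X) M (FObj (Push S j) (FObj (Pull S j) M))"
  using Pull_Push_adjunction[OF j]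
  by (auto simp: adjunction_def nat_trans_def comp_func_def id_func_def)

context
  fixes B :: 'o and e :: int
  assumes B: "B \<in> Obj (Sheaf S U)"
begin

lemma shift_comparison_Push:
  "shift_comparison (Sheaf S U) (Sheaf S X) (Push S j) e B \<in>
     Hom (Sheaf S X) (FObj (Push S j) (ShiftObj (Sheaf S U) e B)) (ShiftObj (Sheaf S X) e (FObj (Push S j) B))"
  "iso_arrow (Sheaf S X) (shift_comparison (Sheaf S U) (Sheaf S X) (Push S j) e B)"
  using shift_comparison[OF CU.triangulated_category_axioms CX.triangulated_category_axioms
      Push_exact[OF j] B] by auto

text \<open>\<open>from_open\<close> is a composite of four additive maps: precomposition with the
  inverse of \<open>FUnit\<close>, the direct image on arrows, postcomposition with the shift
  comparison, and precomposition with the adjunction unit.\<close>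

lemma from_open_group_hom:
  "group_hom (cohomology S U B e) (cohomology S X (FObj (Push S j) B) e) (from_open S j B e)"
proof -
  let ?CU = "Sheaf S U" and ?CX = "Sheaf S X"
  let ?B = "ShiftObj ?CU e B" and ?jB = "ShiftObj ?CX e (FObj (Push S j) B)"
  let ?s = "shift_comparison ?CU ?CX (Push S j) e B" and ?u = "inv_arrow ?CU (FUnit (Pull S j))"
  let ?P = "FObj (Pull S j) (Unit ?CX)"
  have F: "is_functor ?CU ?CX (Push S j)" using Push_additive by (simp add: additive_functor_def)
  have P: "?P \<in> Obj ?CU" using CU.Hom_Obj(2)[OF FUnit_Pull(1)] .
  have obj: "?B \<in> Obj ?CU" "?jB \<in> Obj ?CX"
    using CU.ShiftObj_closed[OF B] CX.Hom_Obj[OF shift_comparison_Push(1)] by auto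
  have 1: "group_hom (Hom_group ?CU (Unit ?CU) ?B) (Hom_group ?CU ?P ?B) (\<lambda>u. u \<cdot>\<^bsub>?CU\<^esub> ?u)"
    by (rule CU.group_hom_Comp_right[OF CU.inv_arrow(1)[OF FUnit_Pull] obj(1)])
  have 2: "group_hom (Hom_group ?CU ?P ?B) (Hom_group ?CX (FObj (Push S j) ?P) (FObj (Push S j) ?B))
      (FArr (Push S j))"
    by (rule additive_functor_group_hom[OF CU.additive_category_axioms CX.additive_category_axioms
          Push_additive P obj(1)])
  have 3: "group_hom (Hom_group ?CX (FObj (Push S j) ?P) (FObj (Push S j) ?B))
      (Hom_group ?CX (FObj (Push S j) ?P) ?jB) (\<lambda>f. ?s \<cdot>\<^bsub>?CX\<^esub> f)"
    by (rule CX.group_hom_Comp_left[OF functor_Obj[OF F P] shift_comparison_Push(1)])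
  have 4: "group_hom (Hom_group ?CX (FObj (Push S j) ?P) ?jB) (Hom_group ?CX (Unit ?CX) ?jB)
      (\<lambda>f. f \<cdot>\<^bsub>?CX\<^esub> AdjUnit S j (Unit ?CX))"
    by (rule CX.group_hom_Comp_right[OF AdjUnit_in_Hom[OF CX.Unit_closed] obj(2)])
  have "from_open S j B e = (\<lambda>f. f \<cdot>\<^bsub>?CX\<^esub> AdjUnit S j (Unit ?CX)) \<circ> ((\<lambda>f. ?s \<cdot>\<^bsub>?CX\<^esub> f) \<circ>
      (FArr (Push S j) \<circ> (\<lambda>u. u \<cdot>\<^bsub>?CU\<^esub> ?u)))"
    by (simp add: from_open_def fun_eq_iff Hom_Spaces Let_def)
  then have "from_open S j B e \<in> hom (Hom_group ?CU (Unit ?CU) ?B) (Hom_group ?CX (Unit ?CX) ?jB)"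
    using hom_compose[OF hom_compose[OF hom_compose[OF
          1[THEN group_hom.homh] 2[THEN group_hom.homh]] 3[THEN group_hom.homh]] 4[THEN group_hom.homh]]
    by simp
  then show ?thesis
    using 1 4 by (auto simp: cohomology_def intro!: group_hom.intro group_hom_axioms.intro
        dest: group_hom.axioms)
qed

text \<open>\<open>from_open\<close> undoes the three stages of \<open>to_open\<close> in reverse
  order: \<open>FUnit\<close> cancels its inverse, \<open>adjunction_transpose\<close> undoes the
  transposition, and the shift comparison cancels its inverse. Hence \<open>from_open\<close> is
  onto, and by its additivity a class killed by \<open>to_open\<close> is zero.\<close>

lemma from_open_to_open:
  assumes "v \<in> carrier (cohomology S X (FObj (Push S j) B) e)"
  shows "to_open S j B e v \<in> carrier (cohomology S U B e)"
    and "from_open S j B e (to_open S j B e v) = v"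
proof -
  let ?CU = "Sheaf S U" and ?CX = "Sheaf S X"
  let ?B = "ShiftObj ?CU e B"
  let ?s = "shift_comparison ?CU ?CX (Push S j) e B" and ?u = "FUnit (Pull S j)"
  let ?w = "inv_arrow ?CX ?s \<cdot>\<^bsub>?CX\<^esub> v"
  let ?w' = "AdjCounit S j ?B \<cdot>\<^bsub>?CU\<^esub> FArr (Pull S j) ?w"
  have v: "v \<in> Hom ?CX (Unit ?CX) (ShiftObj ?CX e (FObj (Push S j) B))"
    using assms by (simp add: cohomology_def)
  have F: "is_functor ?CU ?CX (Push S j)" using Push_additive by (simp add: additive_functor_def)
  have B': "?B \<in> Obj ?CU" by (rule CU.ShiftObj_closed[OF B])
  have w: "?w \<in> Hom ?CX (Unit ?CX) (FObj (Push S j) ?B)"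
    by (rule CX.Comp_in_Hom[OF v CX.inv_arrow(1)[OF shift_comparison_Push]])
  note w' = adjunction_transpose[OF CX.category_axioms CU.category_axioms Pull_Push_adjunction[OF j]
      CX.Unit_closed B' w]
  have to: "to_open S j B e v = ?w' \<cdot>\<^bsub>?CU\<^esub> ?u" by (simp add: to_open_def Hom_Spaces Let_def)
  show "to_open S j B e v \<in> carrier (cohomology S U B e)"
    using CU.Comp_in_Hom[OF FUnit_Pull(1) w'(1)] by (simp add: to cohomology_def)
  have "to_open S j B e v \<cdot>\<^bsub>?CU\<^esub> inv_arrow ?CU ?u = ?w'"
    using CU.Comp_assoc[OF CU.inv_arrow(1)[OF FUnit_Pull] FUnit_Pull(1) w'(1)]
      CU.inv_arrow(3)[OF FUnit_Pull] CU.Ident_right[OF w'(1)] by (simp add: to)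
  then have "from_open S j B e (to_open S j B e v) =
      (?s \<cdot>\<^bsub>?CX\<^esub> FArr (Push S j) ?w') \<cdot>\<^bsub>?CX\<^esub> AdjUnit S j (Unit ?CX)"
    by (simp add: from_open_def Hom_Spaces Let_def)
  also have "\<dots> = ?s \<cdot>\<^bsub>?CX\<^esub> ?w"
    using CX.Comp_assoc[OF AdjUnit_in_Hom[OF CX.Unit_closed] functor_Hom[OF F w'(1)]
        shift_comparison_Push(1)] w'(2) by simp
  also have "\<dots> = v" by (rule CX.inv_Comp_cancel[OF shift_comparison_Push v])
  finally show "from_open S j B e (to_open S j B e v) = v" .
qed

end

end

end

section \<open>The localisation sequence\<close>

locale localisation_sequence = coefficient_system S
  for S :: "('x, 's, 'o, 'm) coefficient_system" +
  fixes i j :: 's and R :: "('o, 'm) recollement" and Z X U :: 'x and A :: 'o and d :: int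
  assumes recollement: "recollement S i j R"
    and i: "i \<in> Hom (Spaces S) Z X" and j: "j \<in> Hom (Spaces S) U X"
    and A: "A \<in> Obj (Sheaf S X)"
begin

abbreviation "HZ \<equiv> supp_cohomology S R i A d"
abbreviation "HX \<equiv> cohomology S X A d"

lemma Cod_i: "Cod (Spaces S) i = X" and Cod_j: "Cod (Spaces S) j = X" and Dom_j: "Dom (Spaces S) j = U"
  using i j by (auto simp: Hom_def)

sublocale CX: sm_triangulated_category "Sheaf S X"
  using Sheaf_category Hom_Spaces(4)[OF j] by blast

lemma triangle:
  "dist_triangle (Sheaf S X) (FObj (Push S i) (FObj (UShriek R) A)) A (FObj (Push S j) (FObj (Pull S j) A))
    (UShriekCounit R A) (AdjUnit S j A) (RBound R A)"
  using recollement.R_triangle[OF recollement] A by (simp add: Cod_i)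

lemmas triangle_Hom = CX.dist_triangle_Hom[OF triangle]

lemma Pull_A: "FObj (Pull S j) A \<in> Obj (Sheaf S U)"
  using functor_Obj[OF _ A] Pull_exact[OF j] by (auto simp: exact_functor_def additive_functor_def)

lemma forg_group_hom: "group_hom HZ HX (forg S R i A d)"
  using CX.group_hom_Comp_left[OF CX.Unit_closed CX.ShiftArr_in_Hom[OF triangle_Hom(4), of d]]
  by (simp add: supp_cohomology_def cohomology_def forg_def[abs_def] Cod_i Let_def)

lemma comm_group_HZ: "comm_group HZ"
  using CX.Hom_comm_group[OF CX.Unit_closed CX.ShiftObj_closed[OF triangle_Hom(1)]]
  by (simp add: supp_cohomology_def cohomology_def Cod_i)

text \<open>Exactness at \<open>H\<^sub>Z\<^sup>d(X; A)\<close>. As \<open>from_open\<close> is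
  onto, the image of \<delta> is the image of postcomposition with the boundary map in degree d-1,
  which the triangle identifies with the kernel of the translated counit.\<close>

lemma GZ_eq_kernel: "GZ S R j A d = kernel HZ HX (forg S R i A d)"
proof -
  let ?CX = "Sheaf S X"
  let ?f = "UShriekCounit R A" and ?h = "RBound R A" and ?jA = "FObj (Push S j) (FObj (Pull S j) A)"
  let ?from = "from_open S j (FObj (Pull S j) A) (d - 1)"
  interpret from_open: group_hom "cohomology S U (FObj (Pull S j) A) (d - 1)" "cohomology S X ?jA (d - 1)" ?from
    by (rule from_open_group_hom[OF j Pull_A])
  have surj: "?from ` carrier (cohomology S U (FObj (Pull S j) A) (d - 1)) =
      Hom ?CX (Unit ?CX) (ShiftObj ?CX (d - 1) ?jA)" (is "_ = ?V")
    using from_open_to_open[OF j Pull_A, of _ "d - 1"] from_open.hom_closed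
    by (force simp: cohomology_def image_iff)
  have "GZ S R j A d = (\<lambda>v. ShiftArr ?CX (d - 1) ?h \<cdot>\<^bsub>?CX\<^esub> v) ` ?V"
    unfolding surj[symmetric] GZ_def
    by (simp add: Dom_j Cod_j image_image connecting_def Let_def)
  also have "\<dots> = kernel HZ HX (forg S R i A d)"
  proof (intro equalityI subsetI)
    note h = CX.ShiftArr_in_Hom[OF triangle_Hom(6), of "d - 1"]
      and f = CX.ShiftArr_in_Hom[OF triangle_Hom(4), of d]
    fix s assume "s \<in> (\<lambda>v. ShiftArr ?CX (d - 1) ?h \<cdot>\<^bsub>?CX\<^esub> v) ` ?V"
    then obtain v where v: "v \<in> ?V" and s: "s = ShiftArr ?CX (d - 1) ?h \<cdot>\<^bsub>?CX\<^esub> v" by blast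
    \<comment> \<open>The boundary map already ends in a translate by 1, so translating it by d-1
      lands in degree d.\<close>
    have h': "ShiftArr ?CX (d - 1) ?h \<in> Hom ?CX (ShiftObj ?CX (d - 1) ?jA)
        (ShiftObj ?CX d (FObj (Push S i) (FObj (UShriek R) A)))"
      using h by (simp add: CX.ShiftObj_Suc[OF triangle_Hom(1)])
    have "ShiftArr ?CX d ?f \<cdot>\<^bsub>?CX\<^esub> s = ZeroArr ?CX (Unit ?CX) (ShiftObj ?CX d A)"
      using CX.Comp_assoc[OF v h' f] CX.dist_triangle_boundary_zero[OF triangle, of "d - 1"]
        CX.ZeroArr_Comp[OF v CX.ShiftObj_closed[OF A]] by (simp add: s)
    then show "s \<in> kernel HZ HX (forg S R i A d)"
      using CX.Comp_in_Hom[OF v h']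
      by (simp add: kernel_def supp_cohomology_def cohomology_def forg_def Cod_i Let_def s)
  next
    fix s assume "s \<in> kernel HZ HX (forg S R i A d)"
    then have "s \<in> Hom ?CX (Unit ?CX) (ShiftObj ?CX d (FObj (Push S i) (FObj (UShriek R) A)))"
      and "ShiftArr ?CX d ?f \<cdot>\<^bsub>?CX\<^esub> s = ZeroArr ?CX (Unit ?CX) (ShiftObj ?CX d A)"
      by (auto simp: kernel_def supp_cohomology_def cohomology_def forg_def Cod_i Let_def)
    then show "s \<in> (\<lambda>v. ShiftArr ?CX (d - 1) ?h \<cdot>\<^bsub>?CX\<^esub> v) ` ?V"
      using CX.dist_triangle_boundary_lift[OF triangle, of s _ "d - 1"] by auto
  qed
  finally show ?thesis .
qed

text \<open>Exactness at \<open>H\<^sup>d(X; A)\<close>: once the composite of \<open>c\<close> with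
  the translated adjunction unit vanishes, the triangle lifts \<open>c\<close> through the
  translated counit.\<close>

lemma Lift_nonempty:
  assumes c: "c \<in> carrier HX" and 0: "restriction S j A d c = \<one>\<^bsub>cohomology S U (FObj (Pull S j) A) d\<^esub>"
  shows "Lift S R i A d c \<noteq> {}"
proof -
  let ?CX = "Sheaf S X"
  let ?v = "ShiftArr ?CX d (AdjUnit S j A) \<cdot>\<^bsub>?CX\<^esub> c"
  have c': "c \<in> Hom ?CX (Unit ?CX) (ShiftObj ?CX d A)" using c by (simp add: cohomology_def)
  have v: "?v \<in> carrier (cohomology S X (FObj (Push S j) (FObj (Pull S j) A)) d)"
    using CX.Comp_in_Hom[OF c' CX.ShiftArr_in_Hom[OF triangle_Hom(5)]] by (simp add: cohomology_def)
  \<comment> \<open>The hypothesis says that \<open>to_open\<close> sends \<open>?v\<close> to zero.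
    Applying the additive map \<open>from_open\<close> recovers \<open>?v\<close> itself as
    zero.\<close>
  have "?v = \<one>\<^bsub>cohomology S X (FObj (Push S j) (FObj (Pull S j) A)) d\<^esub>"
    using from_open_to_open(2)[OF j Pull_A v] 0 group_hom.hom_one[OF from_open_group_hom[OF j Pull_A, of d]]
    by (simp add: restriction_def Cod_j Let_def)
  then show ?thesis
    using CX.dist_triangle_lift_shift[OF triangle c']
    by (auto simp: cohomology_def supp_cohomology_def Lift_def forg_def Cod_i Let_def)
qed

end

text \<open>Nonemptiness is a separate conjunct because \<open>transitive_action\<close> also holds
  for the empty set. The absence of a canonical equivalence is expressed by the last two conjuncts:
  equivalences from the terminal groupoid exist in bijection with supported refinements.\<close>

theorem proposition4p4:
  fixes S :: "('x, 's, 'o, 'm) coefficient_system"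
    and R :: "('o, 'm) recollement"
    and i j :: 's and X Z U :: 'x and A :: 'o and c :: 'm and d :: int
  assumes "coefficient_system S"
    and "i \<in> Hom (Spaces S) Z X" and "i \<in> ClosedImm S"
    and "j \<in> Hom (Spaces S) U X" and "(i, j) \<in> OpenCompl S"
    and "recollement S i j R"
    and "A \<in> Obj (Sheaf S X)"
    and "c \<in> carrier (cohomology S X A d)"
    and "restriction S j A d c = \<one>\<^bsub>cohomology S U (FObj (Pull S j) A) d\<^esub>"
  shows "let H = supp_cohomology S R i A d;
             G = GZ_group S R i j A d;
             Lifts = Lift S R i A d c;
             \<L> = lift_groupoid S R i j A d c
         in
           subgroup (GZ S R j A d) H
           \<and> transitive_action G Lifts (translation S R i A d c)
           \<and> Lifts \<noteq> {}
           \<and> (\<forall>s\<in>Lifts. stabilizer G (translation S R i A d c) s = {\<one>\<^bsub>G\<^esub>})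
           \<and> groupoid \<L>
           \<and> Obj \<L> = Lifts
           \<and> (\<forall>c\<^sub>1\<in>Lifts. \<forall>c\<^sub>2\<in>Lifts. \<exists>!g. g \<in> GZ S R j A d \<and> c\<^sub>1 \<otimes>\<^bsub>H\<^esub> g = c\<^sub>2)
           \<and> (\<forall>c\<^sub>1\<in>Lifts. \<forall>c\<^sub>2\<in>Lifts.
                Hom \<L> c\<^sub>1 c\<^sub>2 = {(c\<^sub>1, THE g. g \<in> GZ S R j A d \<and> c\<^sub>1 \<otimes>\<^bsub>H\<^esub> g = c\<^sub>2, c\<^sub>2)})
           \<and> connected_groupoid \<L>
           \<and> (\<forall>s\<in>Obj \<L>. Hom \<L> s s = {Ident \<L> s})
           \<and> equivalent_categories \<L> terminal_groupoid
           \<and> {F :: (unit, unit, 'm, 'm \<times> 'm \<times> 'm) func. is_equivalence terminal_groupoid \<L> F} =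
               {F. is_functor terminal_groupoid \<L> F}
           \<and> bij_betw (\<lambda>F :: (unit, unit, 'm, 'm \<times> 'm \<times> 'm) func. FObj F ())
               {F. is_equivalence terminal_groupoid \<L> F} Lifts"
proof -
  interpret localisation_sequence S i j R Z X U A d
    using assms(1,2,4,6,7) by (intro localisation_sequence.intro localisation_sequence_axioms.intro)
  interpret forg: group_hom HZ HX "forg S R i A d" by (rule forg_group_hom)
  let ?G = "GZ_group S R i j A d" and ?E = "Lift S R i A d c" and ?\<phi> = "translation S R i A d c"
  let ?L = "lift_groupoid S R i j A d c"
  have E: "?E = {s \<in> carrier HZ. forg S R i A d s = c}" by (simp add: Lift_def)
  have G: "?G = HZ\<lparr>carrier := kernel HZ HX (forg S R i A d)\<rparr>"
    by (simp add: GZ_group_def GZ_eq_kernel)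
  have \<phi>: "?\<phi> = (\<lambda>g. \<lambda>s \<in> ?E. s \<otimes>\<^bsub>HZ\<^esub> g)" by (simp add: translation_def fun_eq_iff)
  \<comment> \<open>With \<open>GZ\<close> rewritten as a kernel and \<open>Lift\<close> as a fibre,
    the action is literally the one of \<open>transitive_action_fibre\<close> for
    \<open>forg\<close>.\<close>
  interpret act: transitive_action ?G ?E ?\<phi>
    using forg.transitive_action_fibre[OF comm_group_HZ, of c] unfolding G \<phi> E .
  have nonempty: "?E \<noteq> {}" by (rule Lift_nonempty[OF assms(8,9)])
  have sub: "subgroup (GZ S R j A d) HZ" unfolding GZ_eq_kernel by (rule forg.subgroup_kernel)
  have unique: "\<exists>!g. g \<in> GZ S R j A d \<and> s \<otimes>\<^bsub>HZ\<^esub> g = t" if "s \<in> ?E" "t \<in> ?E" for s t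
    using forg.fibre_unique_translation[of s t] that by (simp add: E GZ_eq_kernel)
  have one: "\<one>\<^bsub>?G\<^esub> \<in> GZ S R j A d" "s \<otimes>\<^bsub>HZ\<^esub> \<one>\<^bsub>?G\<^esub> = s" if "s \<in> ?E" for s
    using that subgroup.one_closed[OF sub] by (simp_all add: G E)
  \<comment> \<open>Freeness is the case \<open>t = s\<close> of \<open>unique\<close>, since the
    neutral element already fixes \<open>s\<close>.\<close>
  have stab: "stabilizer ?G ?\<phi> s = {\<one>\<^bsub>?G\<^esub>}" if s: "s \<in> ?E" for s
    using unique[OF s s] one[OF s] s by (auto simp: stabilizer_def \<phi> GZ_group_def)
  have L: "groupoid ?L" and Obj: "Obj ?L = ?E"
    using act.groupoid_translation_groupoid by (simp_all add: lift_groupoid_def)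
  have Hom: "Hom ?L s t = {(s, THE g. g \<in> GZ S R j A d \<and> s \<otimes>\<^bsub>HZ\<^esub> g = t, t)}"
    if "s \<in> ?E" "t \<in> ?E" for s t
    using theI'[OF unique[OF that]] unique[OF that] that
    by (auto simp: lift_groupoid_def Hom_translation_groupoid \<phi> GZ_group_def)
  \<comment> \<open>Every hom-set is a singleton by \<open>Hom\<close>, so the results on indiscrete
    categories apply from here on.\<close>
  have indisc: "indiscrete ?L"
    using L nonempty by (auto simp: indiscrete_def Obj Hom groupoid_def)
  have conn: "connected_groupoid ?L"
    using L nonempty by (simp add: connected_groupoid_def Obj Hom)
  have Ident: "Hom ?L s s = {Ident ?L s}" if "s \<in> Obj ?L" for s
    using category.Ident_in_Hom[OF groupoid.axioms(1)[OF L] that] that by (simp add: Obj Hom)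
  \<comment> \<open>Equivalences out of the terminal groupoid are the same as functors, so the final
    bijection reduces to \<open>bij_betw_functors_from_terminal\<close>.\<close>
  have equivs: "{F :: (unit, unit, 'm, 'm \<times> 'm \<times> 'm) func. is_equivalence terminal_groupoid ?L F} =
      {F. is_functor terminal_groupoid ?L F}"
    using indiscrete_is_equivalence[OF indiscrete_terminal_groupoid indisc]
    by (auto simp: is_equivalence_def)
  show ?thesis
    unfolding Let_def equivs
    by (intro conjI ballI; (rule refl sub act.transitive_action_axioms nonempty stab L Obj unique Hom
          conn Ident indiscrete_equivalent_terminal[OF indisc]
          bij_betw_functors_from_terminal[OF groupoid.axioms(1)[OF L], unfolded Obj]; assumption))
qed

end
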